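(* Let $\Theta\subseteq\mathbb{R}^m$, let $\mathcal{G}:\Theta\to\mathbb{R}^n$ be a measurable map with range $\mathcal{R}=\mathcal{G}(\Theta)$, let $\alpha>0$, and let $\mathcal{M}\in\mathcal{P}(\Theta)$ and a data distribution $\rho_y\in\mathcal{P}(\mathbb{R}^n)$ be given. Assume all probability distributions involved are absolutely continuous with respect to Lebesgue measure on the corresponding spaces. Let $$\rho_x^*=\operatorname{arg\,min}_{\rho_x\in\mathcal{P}_{2,\mathrm{ac}}(\Theta)}\mathcal{L}(\rho_x),\qquad \mathcal{L}(\rho_x):=\mathrm{KL}(\mathcal{G}_\#\rho_x\|\rho_y)+\alpha\int\log\frac{\rho_x}{\mathcal{M}}\,\rho_x\,\mathrm{d}x .$$ Then $\rho_x^*$ has the property $$\frac{\rho_x^*(\,\cdot\,|\,\mathcal{G}^{-1}(y))}{\mathcal{M}(\,\cdot\,|\,\mathcal{G}^{-1}(y))}=g_\alpha(y)\quad\text{for all }y\in\mathcal{R},$$ where $g_\alpha(y)$ is a constant depending only on $y$ and $\alpha$, and $\rho_x^*(\,\cdot\,|\,\mathcal{G}^{-1}(y))$ and $\mathcal{M}(\,\cdot\,|\,\mathcal{G}^{-1}(y))$ denote the conditional distributions of $\rho_x^*$ and $\mathcal{M}$ on the preimage $\mathcal{G}^{-1}(y)$, respectively. In particular, $$\rho_x^*(x)\propto\mathcal{M}(x)\left[\frac{\rho_y(\mathcal{G}(x))}{\int\delta(\mathcal{G}(x)-\mathcal{G}(x'))\,\mathcal{M}(x')\,\mathrm{d}x'}\right]^{\frac{1}{1+\alpha}}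 .$$
   Context: $\mathcal{P}_{2,\mathrm{ac}}(\Theta)$ is the set of probability measures on $\Theta$ with finite second moment that are absolutely continuous with respect to Lebesgue measure. The same symbol denotes a measure and its density; equalities of densities are understood almost everywhere. $\mathcal{M}$ is a prescribed probability measure for which $\frac{\mathrm{d}\rho_x}{\mathrm{d}\mathcal{M}}$ exists. $\mathrm{KL}(P\|Q)=\int\log\left(\frac{\mathrm{d}P}{\mathrm{d}Q}\right)\mathrm{d}P$ is the Kullback–Leibler divergence and $\#$ is pushforward. The minimization problem is assumed to be well-posed (the minimizer exists). $\int\delta(y-\mathcal{G}(x'))\,\mathcal{M}(x')\,\mathrm{d}x'$ denotes the Lebesgue density at $y$ of $\mathcal{G}_\#\mathcal{M}$, i.e. the function $w$ with $\int f(\mathcal{G}(x))\mathcal{M}(x)\,\mathrm{d}x=\int f(y)w(y)\,\mathrm{d}y$ for all test functions $f$; with $\mathcal{G}(x)$ in place of $y$ it means $w(\mathcal{G}(x))$. Conditional distributions on level sets $\mathcal{G}^{-1}(y)$ are those given by disintegration with respect to $\mathcal{G}$, and their ratio is the Radon–Nikodym derivative on $\mathcal{G}^{-1}(y)$; since disintegrations are defined up to null sets, "for all $y$" is understood for almost every $y$ with respect to $\mathcal{G}_\#\rho_x^*$. The symbol $\propto$ means equality up to a positive normalizing constant independent of $x$. *)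

theory Defs
  imports "HOL-Probability.Probability"
begin

text \<open>Measures on \<open>\<Theta>\<close> live on the trace Borel sigma-algebra; \<open>leb_on \<Theta>\<close> is Lebesgue
  measure there, and \<open>dens \<Lambda> P\<close> is the real-valued density of \<open>P\<close> with respect to \<open>\<Lambda>\<close>
  (determined \<open>\<Lambda>\<close>-almost everywhere when \<open>P\<close> is absolutely continuous).\<close>

abbreviation leb_on :: "(real ^ 'm) set \<Rightarrow> (real ^ 'm) measure" where
  "leb_on \<Theta> \<equiv> restrict_space lborel \<Theta>"

definition dens :: "'a measure \<Rightarrow> 'a measure \<Rightarrow> 'a \<Rightarrow> real" where
  "dens \<Lambda> P x = enn2real (RN_deriv \<Lambda> P x)"

definition P_ac :: "(real ^ 'm) set \<Rightarrow> (real ^ 'm) measure set" where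
  "P_ac \<Theta> = {\<rho>. prob_space \<rho> \<and> sets \<rho> = sets (leb_on \<Theta>) \<and> absolutely_continuous (leb_on \<Theta>) \<rho>}"

definition P2_ac :: "(real ^ 'm) set \<Rightarrow> (real ^ 'm) measure set" where
  "P2_ac \<Theta> = {\<rho> \<in> P_ac \<Theta>. integrable \<rho> (\<lambda>x. (norm x)\<^sup>2)}"

text \<open>\<open>KL_divergence\<close> is real-valued, hence 0 when the integral of the logarithm diverges, and its
  argument order is the reverse of \<open>KL(P\<parallel>Q)\<close>. For probability measures the negative part of
  the logarithm is always integrable, so a non-integrable logarithm means the value \<open>\<infinity>\<close>.\<close>

definition KL :: "'a measure \<Rightarrow> 'a measure \<Rightarrow> ereal" where
  "KL P Q = (if absolutely_continuous Q P \<and> integrable P (entropy_density (exp 1) Q P)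
     then ereal (KL_divergence (exp 1) Q P) else \<infinity>)"

text \<open>The integral of \<open>ln (\<rho> / M) \<rho>\<close> against Lebesgue measure, with value \<open>\<infinity>\<close> if \<open>\<rho>\<close> charges
  a null set of \<open>M\<close> (the real division by zero would hide this) or if the integral diverges;
  the negative part of the integrand is again always integrable.\<close>

definition reg :: "(real ^ 'm) set \<Rightarrow> (real ^ 'm) measure \<Rightarrow> (real ^ 'm) measure \<Rightarrow> ereal" where
  "reg \<Theta> M \<rho> =
    (let f = (\<lambda>x. ln (dens (leb_on \<Theta>) \<rho> x / dens (leb_on \<Theta>) M x) * dens (leb_on \<Theta>) \<rho> x)
     in if absolutely_continuous M \<rho> \<and> integrable (leb_on \<Theta>) f
        then ereal (integral\<^sup>L (leb_on \<Theta>) f) else \<infinity>)"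

definition loss :: "(real ^ 'm) set \<Rightarrow> (real ^ 'm \<Rightarrow> real ^ 'n) \<Rightarrow> (real ^ 'm) measure \<Rightarrow>
    (real ^ 'n) measure \<Rightarrow> real \<Rightarrow> (real ^ 'm) measure \<Rightarrow> ereal" where
  "loss \<Theta> G M \<rho>y \<alpha> \<rho> = KL (distr \<rho> borel G) \<rho>y + ereal \<alpha> * reg \<Theta> M \<rho>"

text \<open>Since \<open>loss\<close> takes the value \<open>\<infinity>\<close>, well-posedness includes that the minimum is finite:
  otherwise every admissible measure would be a minimizer.\<close>

definition minimizer :: "(real ^ 'm) set \<Rightarrow> (real ^ 'm \<Rightarrow> real ^ 'n) \<Rightarrow> (real ^ 'm) measure \<Rightarrow>
    (real ^ 'n) measure \<Rightarrow> real \<Rightarrow> (real ^ 'm) measure \<Rightarrow> bool" where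
  "minimizer \<Theta> G M \<rho>y \<alpha> \<rho> \<longleftrightarrow>
     is_arg_min (loss \<Theta> G M \<rho>y \<alpha>) (\<lambda>\<rho>'. \<rho>' \<in> P2_ac \<Theta>) \<rho> \<and> loss \<Theta> G M \<rho>y \<alpha> \<rho> < \<infinity>"

text \<open>\<open>\<kappa> y\<close> is the conditional distribution \<open>P( \<cdot> | G\<^sup>-\<^sup>1(y))\<close>: a Markov kernel, represented on all
  of \<open>\<Theta>\<close> but concentrated on the level set for almost every \<open>y\<close>.\<close>

definition disintegration :: "(real ^ 'm) set \<Rightarrow> (real ^ 'm \<Rightarrow> real ^ 'n) \<Rightarrow> (real ^ 'm) measure \<Rightarrow>
    (real ^ 'n \<Rightarrow> (real ^ 'm) measure) \<Rightarrow> bool" where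
  "disintegration \<Theta> G P \<kappa> \<longleftrightarrow>
     \<kappa> \<in> borel \<rightarrow>\<^sub>M prob_algebra (restrict_space borel \<Theta>) \<and>
     (AE y in distr P borel G. emeasure (\<kappa> y) {x \<in> \<Theta>. G x \<noteq> y} = 0) \<and>
     (\<forall>A \<in> sets P. emeasure P A = (\<integral>\<^sup>+ y. emeasure (\<kappa> y) A \<partial>distr P borel G))"

end

theory Submission
  imports Defs
begin

text \<open>Write \<open>\<rho> = f M\<close>, let \<open>F\<close> be the density of the pushforward of \<open>\<rho>\<close> under \<open>G\<close> with respect to that of
  \<open>M\<close>, and let \<open>u\<close> be the quotient of the Lebesgue densities of \<open>\<rho>y\<close> and of the pushforward of \<open>M\<close>.
  Then (lemma \<open>loss_density\<close>) the loss is

  \<open>L = \<integral> (ln (F(G) / u(G)) + \<alpha> * ln f) d\<rho>\<close>.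

  With \<open>\<beta> = 1 / (1 + \<alpha>)\<close> and \<open>Z = \<integral> u(G) powr \<beta> dM\<close>, which is finite because \<open>\<integral> u(G) dM \<le> 1\<close>,
  the measure \<open>\<rho>0 = (u(G) powr \<beta> / Z) M\<close> is the Gibbs measure of this functional. Formally
  \<open>L = KL(G#\<rho> || G#\<rho>0) + \<alpha> * KL(\<rho> || \<rho>0) - (1 + \<alpha>) * ln Z\<close>, so that \<open>- (1 + \<alpha>) * ln Z\<close> is a lower
  bound attained by \<open>\<rho>0\<close> alone. The two divergences need not be finite a priori, so the bound and its
  equality case are derived in a single step, from \<open>ln t \<le> t - 1\<close> and the tangent bound
  \<open>s powr \<beta> \<le> 1 - \<beta> + \<beta> * s\<close> (lemma \<open>functional_at_lower_bound\<close>).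

  A second difficulty is that \<open>\<rho>0\<close> need not have a second moment. Its normalized restrictions to
  balls are admissible, and their loss is at most \<open>- (1 + \<alpha>) * ln Z\<^sub>n\<close> with \<open>Z\<^sub>n \<longlonglongrightarrow> Z\<close>
  (lemma \<open>functional_truncation_bound\<close>). Hence a minimizer attains the lower bound and equals \<open>\<rho>0\<close>
  (lemma \<open>minimizer_density\<close>), which is the formula for the density.

  The weight \<open>u(G) powr \<beta> / Z\<close> is constant on every level set of \<open>G\<close>, so conditioning on a level set
  removes it (lemma \<open>disintegration_fibrewise_reweighting\<close>): the conditional distributions of \<open>\<rho>0\<close>
  and \<open>M\<close> coincide, and their ratio is constant.\<close>

section \<open>Elementary inequalities\<close>

text \<open>The tangent to the concave function \<open>s powr \<beta>\<close> at \<open>s = 1\<close>, which touches the graph only there. In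
  logarithmic form this is the concavity of \<open>ln\<close>, obtained from two instances of
  \<open>ln z \<le> z - 1\<close> at \<open>s / a\<close> and \<open>1 / a\<close>, where \<open>a\<close> is the affine function at \<open>s\<close>; the equality
  case comes from the equality case of \<open>ln z \<le> z - 1\<close>.\<close>

lemma powr_le_affine:
  fixes s \<beta> :: real
  assumes "0 \<le> s" "0 < \<beta>" "\<beta> < 1"
  shows "s powr \<beta> \<le> 1 - \<beta> + \<beta> * s"
    and "s powr \<beta> = 1 - \<beta> + \<beta> * s \<Longrightarrow> s = 1"
proof -
  define a where "a = 1 - \<beta> + \<beta> * s"
  have a: "a > 0" using assms by (simp add: a_def add_pos_nonneg)
  have key: "\<beta> * ln s \<le> ln a \<and> (\<beta> * ln s = ln a \<longrightarrow> s = 1)" if s: "s > 0"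
  proof -
    have 1: "ln (s / a) \<le> s / a - 1" and 2: "ln (1 / a) \<le> 1 / a - 1"
      using s a by (auto intro!: ln_le_minus_one)
    have sum0: "\<beta> * (s / a - 1) + (1 - \<beta>) * (1 / a - 1) = 0"
      using a by (simp add: field_simps) (simp add: a_def algebra_simps)
    have lhs: "\<beta> * ln (s / a) + (1 - \<beta>) * ln (1 / a) = \<beta> * ln s - ln a"
      using s a by (simp add: ln_div algebra_simps)
    have 3: "\<beta> * ln (s / a) \<le> \<beta> * (s / a - 1)" using 1 assms by simp
    have 4: "(1 - \<beta>) * ln (1 / a) \<le> (1 - \<beta>) * (1 / a - 1)"
      using 2 assms by (intro mult_left_mono) auto
    have "s = 1" if "\<beta> * ln s = ln a"
    proof -
      have e3: "\<beta> * ln (s / a) = \<beta> * (s / a - 1)" and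
        e4: "(1 - \<beta>) * ln (1 / a) = (1 - \<beta>) * (1 / a - 1)"
        using that 3 4 sum0 lhs by linarith+
      have "s / a = 1" using e3 assms s a by (intro ln_eq_minus_one) auto
      moreover have "1 / a = 1" using e4 assms a by (intro ln_eq_minus_one) auto
      ultimately show ?thesis using a by (simp add: field_simps)
    qed
    then show ?thesis using 3 4 sum0 lhs by linarith
  qed
  have pw: "s powr \<beta> = exp (\<beta> * ln s)" if "s > 0" using that by (simp add: powr_def)
  show "s powr \<beta> \<le> 1 - \<beta> + \<beta> * s"
  proof (cases "s = 0")
    case False
    then have "s > 0" using assms by simp
    then have "s powr \<beta> \<le> exp (ln a)" using key pw by simp
    then show ?thesis using a by (simp add: a_def)
  qed (use assms in auto)
  show "s = 1" if eq: "s powr \<beta> = 1 - \<beta> + \<beta> * s"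
  proof (cases "s = 0")
    case False
    then have "exp (\<beta> * ln s) = a" using eq pw assms by (simp add: a_def)
    then have "\<beta> * ln s = ln a" by (metis ln_exp)
    then show ?thesis using key False assms by auto
  qed (use assms eq in auto)
qed

text \<open>This bound and the next make the logarithms in the loss of a truncated Gibbs density
  integrable.\<close>

lemma powr_mult_abs_ln_le:
  fixes t \<beta> :: real
  assumes "0 \<le> t" "0 < \<beta>" "\<beta> < 1"
  shows "t powr \<beta> * \<bar>ln t\<bar> \<le> 1 / \<beta> + t / (1 - \<beta>)"
proof (cases "t \<ge> 1")
  case True
  have "t powr \<beta> * \<bar>ln t\<bar> \<le> t powr \<beta> * (t powr (1 - \<beta>) / (1 - \<beta>))"
    using True assms ln_powr_bound[of t "1 - \<beta>"] by (intro mult_left_mono) auto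
  also have "\<dots> = t / (1 - \<beta>)"
    using True by (simp flip: powr_add)
  finally show ?thesis using assms by (simp add: add_increasing)
next
  case False
  show ?thesis
  proof (cases "t = 0")
    case False
    then have t: "0 < t" "t < 1" using \<open>\<not> t \<ge> 1\<close> assms by auto
    have "\<bar>ln t\<bar> = ln (1 / t)" using t by (simp add: ln_div)
    also have "\<dots> \<le> (1 / t) powr \<beta> / \<beta>" using t assms by (intro ln_powr_bound) auto
    finally have "t powr \<beta> * \<bar>ln t\<bar> \<le> t powr \<beta> * ((1 / t) powr \<beta> / \<beta>)"
      by (intro mult_left_mono) auto
    also have "\<dots> = 1 / \<beta>"
      using t by (simp add: powr_divide)
    finally show ?thesis using t assms by (simp add: add_increasing2)
  qed (use assms in auto)
qed

lemma mult_abs_ln_quotient_le: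
  fixes a b :: real
  assumes "0 \<le> a" "a \<le> b"
  shows "a * \<bar>ln (a / b)\<bar> \<le> b"
proof (cases "a = 0")
  case False
  then have a: "0 < a" "0 < b" using assms by auto
  have "\<bar>ln (a / b)\<bar> = ln (b / a)" using a assms by (simp add: ln_div)
  also have "\<dots> \<le> b / a - 1" using a by (intro ln_le_minus_one) auto
  finally have "a * \<bar>ln (a / b)\<bar> \<le> a * (b / a - 1)" using a by (intro mult_left_mono) auto
  also have "\<dots> \<le> b" using a by (simp add: field_simps)
  finally show ?thesis .
qed (use assms in auto)

section \<open>Real-valued densities\<close>

lemma dens_nonneg [simp]: "0 \<le> dens \<Lambda> P x"
  by (simp add: dens_def)

lemma borel_measurable_dens [measurable]: "dens \<Lambda> P \<in> borel_measurable \<Lambda>"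
  unfolding dens_def by measurable

lemma density_dens:
  assumes "sigma_finite_measure \<Lambda>" "finite_measure P" "sets P = sets \<Lambda>" "absolutely_continuous \<Lambda> P"
  shows "density \<Lambda> (\<lambda>x. ennreal (dens \<Lambda> P x)) = P"
proof -
  interpret sigma_finite_measure \<Lambda> by fact
  interpret P: finite_measure P by fact
  have "AE x in \<Lambda>. RN_deriv \<Lambda> P x \<noteq> \<infinity>"
    by (rule RN_deriv_finite) (use assms P.sigma_finite_measure_axioms in auto)
  then have "density \<Lambda> (\<lambda>x. ennreal (dens \<Lambda> P x)) = density \<Lambda> (RN_deriv \<Lambda> P)"
    unfolding dens_def by (intro density_cong) (auto simp: less_top)
  then show ?thesis using density_RN_deriv assms by simp
qed

lemma dens_unique:
  assumes "sigma_finite_measure \<Lambda>" "f \<in> borel_measurable \<Lambda>" "\<And>x. 0 \<le> f x"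
    and "density \<Lambda> (\<lambda>x. ennreal (f x)) = P"
  shows "AE x in \<Lambda>. dens \<Lambda> P x = f x"
proof -
  interpret sigma_finite_measure \<Lambda> by fact
  have "AE x in \<Lambda>. ennreal (f x) = RN_deriv \<Lambda> P x"
    by (rule RN_deriv_unique) (use assms in auto)
  then show ?thesis
    by eventually_elim (metis assms(3) dens_def enn2real_ennreal)
qed

lemma absolutely_continuous_distr:
  assumes ac: "absolutely_continuous M P" and s: "sets P = sets M" and G[measurable]: "G \<in> measurable M N"
  shows "absolutely_continuous (distr M N G) (distr P N G)"
proof -
  have [measurable]: "G \<in> measurable P N" using G s by (simp cong: measurable_cong_sets)
  have sp: "space P = space M" using s by (rule sets_eq_imp_space_eq)
  show ?thesis
    using ac unfolding absolutely_continuous_def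
    by (auto simp: null_sets_distr_iff sp)
qed

text \<open>\<open>F\<close> is the conditional expectation of \<open>f\<close> given \<open>G\<close>, written as a function of the value of \<open>G\<close>.
  If \<open>f\<close> lies below a function of \<open>G\<close>, so does its conditional expectation: the difference
  \<open>H(G) - f\<close> pushes forward to a second density \<open>F'\<close>, and \<open>F + F' = H\<close> by uniqueness.\<close>

lemma dens_distr_le:
  fixes f :: "'a \<Rightarrow> real" and H :: "'b \<Rightarrow> real"
  assumes "finite_measure M" and [measurable]: "G \<in> measurable M N"
    "f \<in> borel_measurable M" "H \<in> borel_measurable N"
    and f: "\<And>x. 0 \<le> f x" "\<And>x. f x \<le> H (G x)" and H: "\<And>y. 0 \<le> H y"
    and int: "integrable M (\<lambda>x. H (G x))"
  defines "F \<equiv> dens (distr M N G) (distr (density M f) N G)"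
  shows "density (distr M N G) (\<lambda>y. ennreal (F y)) = distr (density M f) N G"
    and "AE y in distr M N G. F y \<le> H y"
proof -
  interpret M: finite_measure M by fact
  interpret N: finite_measure "distr M N G" by (rule M.finite_measure_distr) simp
  define f' where "f' x = H (G x) - f x" for x
  have [measurable]: "f' \<in> borel_measurable M" unfolding f'_def by measurable
  have f': "0 \<le> f' x" "f' x \<le> H (G x)" for x using f by (auto simp: f'_def)
  define F' where "F' = dens (distr M N G) (distr (density M f') N G)"
  have main: "density (distr M N G) (\<lambda>y. ennreal (dens (distr M N G) (distr (density M h) N G) y)) =
      distr (density M h) N G"
    if [measurable]: "h \<in> borel_measurable M" and h: "\<And>x. 0 \<le> h x" "\<And>x. h x \<le> H (G x)" for h
  proof (rule density_dens)
    have "integrable M h"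
      by (rule Bochner_Integration.integrable_bound[OF int]) (use h H in \<open>auto simp: abs_of_nonneg\<close>)
    then have "finite_measure (density M h)"
      by (intro finite_measureI) (auto simp: emeasure_density integrable_iff_bounded h abs_of_nonneg
          cong: nn_integral_cong)
    then show "finite_measure (distr (density M h) N G)"
      by (rule finite_measure.finite_measure_distr) simp
    show "sigma_finite_measure (distr M N G)" by unfold_locales
    show "absolutely_continuous (distr M N G) (distr (density M h) N G)"
      by (rule absolutely_continuous_distr) (auto intro!: absolutely_continuousI_density)
  qed simp
  show dF: "density (distr M N G) (\<lambda>y. ennreal (F y)) = distr (density M f) N G"
    unfolding F_def using f by (intro main) auto
  have dF': "density (distr M N G) (\<lambda>y. ennreal (F' y)) = distr (density M f') N G"
    unfolding F'_def using f' by (intro main) auto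
  have [measurable]: "F \<in> borel_measurable N" "F' \<in> borel_measurable N"
    using borel_measurable_dens[of "distr M N G"] unfolding F_def F'_def by auto
  have pos: "0 \<le> F y" "0 \<le> F' y" for y by (auto simp: F_def F'_def)
  have "density (distr M N G) (\<lambda>y. ennreal (F y + F' y)) = density (distr M N G) (\<lambda>y. ennreal (H y))"
  proof (rule measure_eqI)
    fix B assume "B \<in> sets (density (distr M N G) (\<lambda>y. ennreal (F y + F' y)))"
    then have [measurable]: "B \<in> sets N" by simp
    have "emeasure (density (distr M N G) (\<lambda>y. ennreal (F y + F' y))) B =
        emeasure (density (distr M N G) (\<lambda>y. ennreal (F y))) B +
        emeasure (density (distr M N G) (\<lambda>y. ennreal (F' y))) B"
      by (simp add: emeasure_density nn_integral_add[symmetric] pos distrib_right)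
    also have "\<dots> = (\<integral>\<^sup>+x. ennreal (f x) * indicator (G -` B \<inter> space M) x \<partial>M) +
        (\<integral>\<^sup>+x. ennreal (f' x) * indicator (G -` B \<inter> space M) x \<partial>M)"
      unfolding dF dF' by (simp add: emeasure_distr emeasure_density)
    also have "\<dots> = (\<integral>\<^sup>+x. ennreal (H (G x)) * indicator (G -` B \<inter> space M) x \<partial>M)"
      by (simp add: nn_integral_add[symmetric] distrib_right[symmetric] f f' ennreal_plus[symmetric]
          del: ennreal_plus) (simp add: f'_def)
    also have "\<dots> = emeasure (density (distr M N G) (\<lambda>y. ennreal (H y))) B"
      by (simp add: density_distr emeasure_distr emeasure_density)
    finally show "emeasure (density (distr M N G) (\<lambda>y. ennreal (F y + F' y))) B =
      emeasure (density (distr M N G) (\<lambda>y. ennreal (H y))) B" .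
  qed simp
  then have "AE y in distr M N G. ennreal (F y + F' y) = ennreal (H y)"
    by (intro N.density_unique) auto
  then show "AE y in distr M N G. F y \<le> H y"
  proof eventually_elim
    case (elim y)
    then have "F y + F' y = H y" using pos[of y] H[of y] by (simp del: ennreal_plus)
    then show ?case using pos(2)[of y] by linarith
  qed
qed

section \<open>Uniqueness of disintegrations\<close>

lemma disintegration_kernel:
  assumes "disintegration \<Theta> G P \<kappa>"
  shows "prob_space (\<kappa> y)" "sets (\<kappa> y) = sets (restrict_space borel \<Theta>)"
    and "A \<in> sets (restrict_space borel \<Theta>) \<Longrightarrow> (\<lambda>y. emeasure (\<kappa> y) A) \<in> borel_measurable borel"
proof -
  have k: "\<kappa> \<in> borel \<rightarrow>\<^sub>M prob_algebra (restrict_space borel \<Theta>)"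
    using assms by (simp add: disintegration_def)
  from measurable_space[OF k, of y]
  show "prob_space (\<kappa> y)" "sets (\<kappa> y) = sets (restrict_space borel \<Theta>)"
    by (auto simp: space_prob_algebra)
  show "A \<in> sets (restrict_space borel \<Theta>) \<Longrightarrow> (\<lambda>y. emeasure (\<kappa> y) A) \<in> borel_measurable borel"
    by (rule measurable_emeasure_kernel[OF measurable_prob_algebraD[OF k]])
qed

text \<open>For fixed \<open>A\<close>, the function \<open>y \<mapsto> \<kappa> y A\<close> is a density of the pushforward of the restriction of \<open>P\<close>
  to \<open>A\<close>. The defining formula of a disintegration is the case of total mass; concentration on the
  level sets localizes it to each Borel set of values \<open>y\<close>. Uniqueness of disintegrations thereby
  reduces to uniqueness of densities.\<close>

lemma disintegration_slice:
  fixes G :: "real ^ 'm \<Rightarrow> real ^ 'n"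
  assumes dis: "disintegration \<Theta> G P \<kappa>" and s: "sets P = sets (restrict_space borel \<Theta>)"
    and G: "G \<in> borel_measurable (restrict_space borel \<Theta>)" and A: "A \<in> sets P"
  shows "distr (density P (indicator A)) borel G = density (distr P borel G) (\<lambda>y. emeasure (\<kappa> y) A)"
proof (rule measure_eqI)
  fix B assume "B \<in> sets (distr (density P (indicator A)) borel G)"
  then have B[measurable]: "B \<in> sets borel" by simp
  note A[measurable]
  have [measurable]: "G \<in> borel_measurable P" using G s by (simp cong: measurable_cong_sets)
  have [measurable]: "(\<lambda>y. emeasure (\<kappa> y) A) \<in> borel_measurable borel"
    using disintegration_kernel(3)[OF dis] A s by simp
  have sp: "space P = \<Theta>" using sets_eq_imp_space_eq[OF s] by (simp add: space_restrict_space)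
  have conc: "AE y in distr P borel G. emeasure (\<kappa> y) {x \<in> \<Theta>. G x \<noteq> y} = 0"
    using dis by (simp add: disintegration_def)
  let ?C = "A \<inter> (G -` B \<inter> space P)"
  have C: "?C \<in> sets P" by measurable
  have "emeasure (distr (density P (indicator A)) borel G) B = emeasure P ?C"
    by (simp add: emeasure_distr emeasure_density indicator_inter_arith[symmetric])
  also have "\<dots> = (\<integral>\<^sup>+ y. emeasure (\<kappa> y) ?C \<partial>distr P borel G)"
    using dis C by (auto simp: disintegration_def)
  also have "\<dots> = (\<integral>\<^sup>+ y. emeasure (\<kappa> y) A * indicator B y \<partial>distr P borel G)"
  proof (rule nn_integral_cong_AE)
    show "AE y in distr P borel G. emeasure (\<kappa> y) ?C = emeasure (\<kappa> y) A * indicator B y"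
      using conc
    proof eventually_elim
      case (elim y)
      have sk: "sets (\<kappa> y) = sets P" using disintegration_kernel(2)[OF dis] s by simp
      have "{x \<in> space P. G x \<noteq> y} \<in> sets P" by measurable
      then have null: "{x \<in> \<Theta>. G x \<noteq> y} \<in> null_sets (\<kappa> y)" using elim sk sp by (auto simp: null_sets_def)
      have "AE x in \<kappa> y. G x = y"
        by (rule AE_I'[OF null]) (use sets_eq_imp_space_eq[OF sk] sp in auto)
      then have "AE x in \<kappa> y. x \<in> ?C \<longleftrightarrow> x \<in> (if y \<in> B then A else {})"
        using AE_space by eventually_elim (auto simp: sets_eq_imp_space_eq[OF sk])
      then have "emeasure (\<kappa> y) ?C = emeasure (\<kappa> y) (if y \<in> B then A else {})"
        by (rule emeasure_eq_AE) (use A C sk in auto)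
      then show ?case by (simp split: if_splits)
    qed
  qed
  also have "\<dots> = emeasure (density (distr P borel G) (\<lambda>y. emeasure (\<kappa> y) A)) B"
    by (simp add: emeasure_density)
  finally show "emeasure (distr (density P (indicator A)) borel G) B =
      emeasure (density (distr P borel G) (\<lambda>y. emeasure (\<kappa> y) A)) B" .
qed simp

text \<open>A countable base need not be closed under intersection; its finite intersections are, and they
  remain countable.\<close>

lemma borel_countable_Int_stable_generator:
  obtains C :: "'a::second_countable_topology set set"
  where "countable C" "Int_stable C" "UNIV \<in> C" "sets borel = sigma_sets UNIV C"
proof -
  obtain B :: "'a set set" where B: "countable B" "topological_basis B"
    using ex_countable_basis by blast
  define C where "C = Inter ` {F. finite F \<and> F \<subseteq> B}"
  show thesis
  proof
    show "countable C"
      unfolding C_def by (intro countable_image countable_Collect_finite_subset B)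
    show "Int_stable C"
    proof (rule Int_stableI)
      fix a b assume "a \<in> C" "b \<in> C"
      then obtain F F' where "finite F" "F \<subseteq> B" "a = \<Inter>F" "finite F'" "F' \<subseteq> B" "b = \<Inter>F'"
        by (auto simp: C_def)
      then show "a \<inter> b \<in> C" unfolding C_def by (intro image_eqI[of _ _ "F \<union> F'"]) auto
    qed
    show "UNIV \<in> C" unfolding C_def by (intro image_eqI[of _ _ "{}"]) auto
    have "B \<subseteq> C" unfolding C_def by (auto intro!: image_eqI[of _ _ "{b}" for b])
    have "C \<subseteq> sets borel"
      using topological_basis_open[OF B(2)] unfolding C_def by (auto intro!: borel_open open_Inter)
    show "sets borel = sigma_sets UNIV C"
    proof
      have "(borel :: 'a measure) = sigma UNIV B" by (rule borel_eq_countable_basis[OF B])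
      then have "sets (borel :: 'a measure) = sets (sigma UNIV B)" by (rule arg_cong)
      then have "sets (borel :: 'a measure) = sigma_sets UNIV B" by simp
      also have "\<dots> \<subseteq> sigma_sets UNIV C"
        using \<open>B \<subseteq> C\<close> by (rule sigma_sets_mono')
      finally show "sets borel \<subseteq> sigma_sets UNIV C" .
      show "sigma_sets UNIV C \<subseteq> sets borel"
        using sets.sigma_sets_subset[OF \<open>C \<subseteq> sets borel\<close>] by simp
    qed
  qed
qed

text \<open>The exceptional null set may depend on \<open>A\<close>; a countable generating \<open>\<pi>\<close>-system gives one null set
  that serves all \<open>A\<close>.\<close>

lemma AE_kernel_eqI:
  fixes \<Theta> :: "(real ^ 'm) set" and \<kappa> \<kappa>' :: "'b \<Rightarrow> (real ^ 'm) measure"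
  assumes \<kappa>: "\<And>y. prob_space (\<kappa> y)" "\<And>y. sets (\<kappa> y) = sets (restrict_space borel \<Theta>)"
    and \<kappa>': "\<And>y. prob_space (\<kappa>' y)" "\<And>y. sets (\<kappa>' y) = sets (restrict_space borel \<Theta>)"
    and \<Theta>: "\<Theta> \<in> sets borel"
    and eq: "\<And>A. A \<in> sets (restrict_space borel \<Theta>) \<Longrightarrow> AE y in N. emeasure (\<kappa> y) A = emeasure (\<kappa>' y) A"
  shows "AE y in N. \<kappa> y = \<kappa>' y"
proof -
  obtain C :: "(real ^ 'm) set set" where C: "countable C" "Int_stable C" "UNIV \<in> C"
    "sets borel = sigma_sets UNIV C"
    by (rule borel_countable_Int_stable_generator)
  have "C \<subseteq> sets borel" unfolding C(4) by (auto intro: sigma_sets.Basic)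
  then have "AE y in N. \<forall>c\<in>C. emeasure (\<kappa> y) (\<Theta> \<inter> c) = emeasure (\<kappa>' y) (\<Theta> \<inter> c)"
    using \<Theta> by (intro AE_ball_countable' eq C(1)) (auto simp: sets_restrict_space)
  then show ?thesis
  proof eventually_elim
    case (elim y)
    interpret K: prob_space "\<kappa> y" by fact
    have sp: "space (\<kappa> y) = \<Theta>" "space (\<kappa>' y) = \<Theta>"
      using sets_eq_imp_space_eq[OF \<kappa>(2)] sets_eq_imp_space_eq[OF \<kappa>'(2)]
      by (auto simp: space_restrict_space)
    have m: "id \<in> measurable (\<kappa> y) borel" "id \<in> measurable (\<kappa>' y) borel"
      using \<kappa>(2)[of y] \<kappa>'(2)[of y]
      by (auto simp: id_def measurable_restrict_space1 cong: measurable_cong_sets)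
    have e: "emeasure (distr (\<kappa> y) borel id) X = emeasure (\<kappa> y) (\<Theta> \<inter> X)"
      "emeasure (distr (\<kappa>' y) borel id) X = emeasure (\<kappa>' y) (\<Theta> \<inter> X)" if "X \<in> sets borel" for X
      using that m by (auto simp: emeasure_distr sp Int_commute)
    have d: "distr (\<kappa> y) borel id = distr (\<kappa>' y) borel id"
    proof (rule measure_eqI_generator_eq[OF C(2), where \<Omega> = UNIV and A = "\<lambda>_. UNIV"])
      show "emeasure (distr (\<kappa> y) borel id) X = emeasure (distr (\<kappa>' y) borel id) X" if "X \<in> C" for X
        using that elim e \<open>C \<subseteq> sets borel\<close> by auto
      show "emeasure (distr (\<kappa> y) borel id) UNIV \<noteq> \<infinity>"
        using e(1)[of UNIV] by simp
    qed (use C in auto)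
    show "\<kappa> y = \<kappa>' y"
    proof (rule measure_eqI)
      fix X assume "X \<in> sets (\<kappa> y)"
      then have "X \<in> sets borel" "X \<subseteq> \<Theta>"
        using \<Theta> by (auto simp: \<kappa>(2) sets_restrict_space)
      then show "emeasure (\<kappa> y) X = emeasure (\<kappa>' y) X"
        using e[of X] d by (simp add: Int_absorb1)
    qed (simp add: \<kappa> \<kappa>')
  qed
qed

text \<open>A weight that depends on \<open>G x\<close> only is constant on each level set, and normalization of the
  conditional distributions cancels it.\<close>

lemma disintegration_fibrewise_reweighting:
  fixes G :: "real ^ 'm \<Rightarrow> real ^ 'n"
  assumes \<Theta>: "\<Theta> \<in> sets borel" and G: "G \<in> borel_measurable (restrict_space borel \<Theta>)"
    and s: "sets M = sets (restrict_space borel \<Theta>)"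
    and h[measurable]: "h \<in> borel_measurable borel"
    and P: "P = density M (\<lambda>x. h (G x))" "prob_space P"
    and dis: "disintegration \<Theta> G P \<kappa>" "disintegration \<Theta> G M \<kappa>'"
  shows "AE y in distr P borel G. \<kappa> y = \<kappa>' y"
proof (rule AE_kernel_eqI[OF _ _ _ _ \<Theta>])
  fix A assume A: "A \<in> sets (restrict_space borel \<Theta>)"
  have [measurable]: "A \<in> sets M" "G \<in> borel_measurable M"
    using A G s by (auto cong: measurable_cong_sets)
  have [measurable]: "G \<in> borel_measurable P" by (simp add: P)
  have k[measurable]: "(\<lambda>y. emeasure (\<kappa> y) A) \<in> borel_measurable borel"
    "(\<lambda>y. emeasure (\<kappa>' y) A) \<in> borel_measurable borel"
    using dis A by (auto intro: disintegration_kernel)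
  have "density (distr P borel G) (\<lambda>y. emeasure (\<kappa> y) A) = distr (density P (indicator A)) borel G"
    using A s by (intro disintegration_slice[OF dis(1) _ G, symmetric]) (auto simp: P)
  also have "density P (indicator A) = density (density M (indicator A)) (\<lambda>x. h (G x))"
    by (simp add: P density_density_eq mult.commute)
  also have "distr \<dots> borel G = density (distr (density M (indicator A)) borel G) h"
    by (rule density_distr[symmetric]) auto
  also have "distr (density M (indicator A)) borel G =
      density (distr M borel G) (\<lambda>y. emeasure (\<kappa>' y) A)"
    using A s by (intro disintegration_slice[OF dis(2) s G]) auto
  also have "density \<dots> h = density (density (distr M borel G) h) (\<lambda>y. emeasure (\<kappa>' y) A)"
    by (simp add: density_density_eq mult.commute)
  also have "density (distr M borel G) h = distr P borel G"
    by (simp add: P density_distr)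
  finally have eq: "density (distr P borel G) (\<lambda>y. emeasure (\<kappa> y) A) =
      density (distr P borel G) (\<lambda>y. emeasure (\<kappa>' y) A)" .
  interpret D: prob_space "distr P borel G" by (rule prob_space.prob_space_distr[OF P(2)]) simp
  show "AE y in distr P borel G. emeasure (\<kappa> y) A = emeasure (\<kappa>' y) A"
    by (rule D.density_unique[OF _ _ eq]) auto
qed (use dis in \<open>auto intro: disintegration_kernel simp: disintegration_kernel(2)\<close>)

section \<open>Bounds for the functional in terms of densities\<close>

lemma integrable_powr:
  fixes g :: "'a \<Rightarrow> real"
  assumes "finite_measure M" and g: "integrable M g" "\<And>x. 0 \<le> g x" and \<beta>: "0 < \<beta>" "\<beta> < 1"
  shows "integrable M (\<lambda>x. g x powr \<beta>)"
proof -
  interpret finite_measure M by fact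
  have "integrable M (\<lambda>x. 1 - \<beta> + \<beta> * g x)" using g by auto
  then show ?thesis
    by (rule Bochner_Integration.integrable_bound)
       (use g in \<open>auto intro!: AE_I2 order.trans[OF powr_le_affine(1)[OF g(2) \<beta>]]\<close>)
qed

text \<open>Put \<open>\<beta> = 1 / (1 + \<alpha>)\<close> and let \<open>F\<close> be the density of the pushforward of \<open>f M\<close> with respect to the
  pushforward of \<open>M\<close>. With \<open>s = f / F(G)\<close> and \<open>t = u(G) powr \<beta> * s powr \<beta> / (Z * f)\<close> the
  functional is \<open>L = - (1 + \<alpha>) * ln Z - (1 + \<alpha>) * \<integral> ln t\<close>, the integral being taken over \<open>f M\<close>. From
  \<open>ln t \<le> t - 1\<close>, and \<open>\<integral> t \<le> 1\<close> by the tangent bound for \<open>s powr \<beta>\<close> and \<open>F\<close> being the fibre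
  average of \<open>f\<close>, one gets \<open>L \<ge> - (1 + \<alpha>) * ln Z\<close>. If the bound is attained both estimates are
  equalities almost everywhere: the second forces \<open>s = 1\<close> where \<open>u(G) > 0\<close>, so that \<open>f\<close> is constant
  on the fibres there,
  and the first forces \<open>t = 1\<close>, which then determines \<open>f\<close>. Positivity of \<open>Z\<close> holds because absolute
  continuity of the pushforward makes \<open>u(G)\<close> positive almost everywhere for \<open>f M\<close>.\<close>

lemma functional_at_lower_bound:
  fixes f :: "'a \<Rightarrow> real" and F u :: "'b \<Rightarrow> real" and \<alpha> :: real
  assumes M: "prob_space M" and [measurable]: "G \<in> measurable M N"
    "f \<in> borel_measurable M" "F \<in> borel_measurable N" "u \<in> borel_measurable N"
    and f: "\<And>x. 0 \<le> f x" and F: "\<And>y. 0 \<le> F y" and u: "\<And>y. 0 \<le> u y"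
    and \<rho>: "prob_space (density M f)"
    and push: "distr (density M f) N G = density (distr M N G) F"
    and supp: "AE x in M. u (G x) = 0 \<longrightarrow> F (G x) = 0"
    and \<alpha>: "\<alpha> > 0"
    and intZ: "integrable M (\<lambda>x. u (G x) powr (1 / (1 + \<alpha>)))"
    and int1: "integrable (density M f) (\<lambda>x. ln (F (G x) / u (G x)))"
    and int2: "integrable (density M f) (\<lambda>x. ln (f x))"
  defines "Z \<equiv> \<integral>x. u (G x) powr (1 / (1 + \<alpha>)) \<partial>M"
    and "L \<equiv> (\<integral>x. ln (F (G x) / u (G x)) \<partial>density M f) + \<alpha> * (\<integral>x. ln (f x) \<partial>density M f)"
  shows "Z > 0"
    and "L \<le> - (1 + \<alpha>) * ln Z \<Longrightarrow> AE x in M. f x = u (G x) powr (1 / (1 + \<alpha>)) / Z"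
proof -
  interpret M: prob_space M by fact
  interpret R: prob_space "density M f" by fact
  have mass1: "measure (density M f) (space M) = 1" using R.prob_space by simp
  define \<beta> where "\<beta> = 1 / (1 + \<alpha>)"
  have \<beta>: "0 < \<beta>" "\<beta> < 1" "(1 + \<alpha>) * \<beta> = 1" using \<alpha> by (auto simp: \<beta>_def field_simps)
  have Zdef: "Z = (\<integral>x. u (G x) powr \<beta> \<partial>M)" by (simp add: Z_def \<beta>_def)
  have intb: "integrable M (\<lambda>x. u (G x) powr \<beta>)" using intZ by (simp add: \<beta>_def)

  have "AE y in distr (density M f) N G. 0 < F y"
    unfolding push by (simp add: AE_density)
  then have Fpos: "AE x in density M f. 0 < F (G x)"
    by (subst (asm) AE_distr_iff) auto
  have fpos: "AE x in density M f. 0 < f x"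
    by (simp add: AE_density)
  have "AE x in density M f. u (G x) = 0 \<longrightarrow> F (G x) = 0"
    using supp by (auto simp: AE_density)
  then have upos: "AE x in density M f. 0 < u (G x)"
    using Fpos by eventually_elim (use u in \<open>auto simp: less_le\<close>)
  have "Z \<ge> 0" unfolding Zdef by simp
  moreover have "Z \<noteq> 0"
  proof
    assume "Z = 0"
    then have "AE x in M. u (G x) powr \<beta> = 0"
      unfolding Zdef by (subst (asm) integral_nonneg_eq_0_iff_AE[OF intb]) auto
    then have "AE x in density M f. u (G x) powr \<beta> = 0" by (auto simp: AE_density)
    with upos have "AE x in density M f. False"
      by eventually_elim auto
    then show False by simp
  qed
  ultimately show Zpos: "Z > 0" by simp

  define s where "s x = f x / F (G x)" for x
  define v where "v x = u (G x) powr \<beta>" for x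
  have [measurable]: "s \<in> borel_measurable M" "v \<in> borel_measurable M"
    unfolding s_def v_def by measurable
  have s: "0 \<le> s x" and v: "0 \<le> v x" for x by (auto simp: s_def v_def f F)
  have int_v: "integrable M v" and Z_v: "(\<integral>x. v x \<partial>M) = Z"
    using intb unfolding v_def[abs_def] Zdef by auto

  \<comment> \<open>Since \<open>F\<close> is the average of \<open>f\<close> over the fibres, the quotient \<open>s\<close> averages to at most one
    on each fibre, and \<open>v\<close> is constant there.\<close>
  have vs: "integrable M (\<lambda>x. v x * s x)" "(\<integral>x. v x * s x \<partial>M) \<le> Z"
  proof -
    have "(\<integral>\<^sup>+x. ennreal (v x * s x) \<partial>M) = (\<integral>\<^sup>+x. ennreal (u (G x) powr \<beta> / F (G x)) \<partial>density M f)"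
      by (subst nn_integral_density)
         (auto intro!: nn_integral_cong simp: v_def s_def f F ennreal_mult[symmetric] mult.commute)
    also have "\<dots> = (\<integral>\<^sup>+y. ennreal (u y powr \<beta> / F y) \<partial>distr (density M f) N G)"
      by (simp add: nn_integral_distr)
    also have "\<dots> = (\<integral>\<^sup>+x. ennreal (F (G x) * (u (G x) powr \<beta> / F (G x))) \<partial>M)"
      unfolding push
      by (subst nn_integral_density)
         (auto simp: nn_integral_distr F ennreal_mult[symmetric] intro!: nn_integral_cong)
    also have "\<dots> \<le> (\<integral>\<^sup>+x. ennreal (v x) \<partial>M)"
      by (intro nn_integral_mono ennreal_leI) (auto simp: v_def)
    also have "\<dots> = ennreal Z"
      using int_v v Z_v by (simp add: nn_integral_eq_integral)
    finally have le: "(\<integral>\<^sup>+x. ennreal (v x * s x) \<partial>M) \<le> ennreal Z" .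
    show "integrable M (\<lambda>x. v x * s x)"
      by (rule integrableI_nonneg) (use le s v in \<open>auto intro: order.strict_trans1\<close>)
    then show "(\<integral>x. v x * s x \<partial>M) \<le> Z"
      using le s v Zpos by (subst (asm) nn_integral_eq_integral) auto
  qed
  \<comment> \<open>The loss in the tangent bound; its integral controls how far \<open>\<integral> t\<close> stays below one.\<close>
  define gap where "gap x = v x * (1 - \<beta> + \<beta> * s x) - v x * s x powr \<beta>" for x
  have gap_nonneg: "0 \<le> gap x" for x
    using powr_le_affine(1)[OF s \<beta>(1,2), of x] v[of x] by (simp add: gap_def mult_left_mono)
  have int_aff: "integrable M (\<lambda>x. v x * (1 - \<beta> + \<beta> * s x))"
    using int_v vs(1) by (simp add: distrib_left mult.left_commute[of _ \<beta>] right_diff_distrib)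
  have int_q: "integrable M (\<lambda>x. v x * s x powr \<beta>)"
    by (rule Bochner_Integration.integrable_bound[OF int_aff])
       (use gap_nonneg v in \<open>auto simp: gap_def intro!: AE_I2 order.trans[OF _ abs_ge_self]\<close>)
  have int_gap: "integrable M gap"
    unfolding gap_def[abs_def] using int_aff int_q by (rule Bochner_Integration.integrable_diff)
  have gap_le: "(\<integral>x. gap x \<partial>M) \<le> Z - (\<integral>x. v x * s x powr \<beta> \<partial>M)"
  proof -
    have "(\<integral>x. v x * (1 - \<beta> + \<beta> * s x) \<partial>M) = (1 - \<beta>) * Z + \<beta> * (\<integral>x. v x * s x \<partial>M)"
    proof -
      have "(\<integral>x. v x * (1 - \<beta> + \<beta> * s x) \<partial>M) = (\<integral>x. (1 - \<beta>) * v x + \<beta> * (v x * s x) \<partial>M)"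
        by (simp add: algebra_simps)
      then show ?thesis using int_v vs(1) Z_v by simp
    qed
    also have "\<dots> \<le> (1 - \<beta>) * Z + \<beta> * Z" using vs(2) \<beta> by simp
    also have "\<dots> = Z" by (simp add: algebra_simps)
    finally show ?thesis
      unfolding gap_def[abs_def] using int_aff int_q by (subst Bochner_Integration.integral_diff) auto
  qed

  define t where "t x = v x * s x powr \<beta> / (Z * f x)" for x
  have [measurable]: "t \<in> borel_measurable M" unfolding t_def by measurable
  have tf: "f x * t x = v x * s x powr \<beta> / Z" for x
  proof (cases "f x = 0")
    case True
    then show ?thesis by (simp add: s_def)
  next
    case False
    then show ?thesis using Zpos by (simp add: t_def)
  qed
  have int_t: "integrable (density M f) t"
    by (subst integrable_density) (use f tf int_q in auto)
  have t_eq: "(\<integral>x. t x \<partial>density M f) = (\<integral>x. v x * s x powr \<beta> \<partial>M) / Z"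
    by (subst integral_density) (use f tf in auto)
  have lnt: "AE x in density M f. 0 < t x \<and>
      ln (F (G x) / u (G x)) + \<alpha> * ln (f x) + (1 + \<alpha>) * ln Z = - (1 + \<alpha>) * ln (t x)"
    using Fpos fpos upos
  proof eventually_elim
    case (elim x)
    have sp: "s x > 0" using elim by (simp add: s_def)
    have vp: "v x > 0" using elim by (simp add: v_def)
    have "ln (t x) = \<beta> * ln (u (G x)) + \<beta> * (ln (f x) - ln (F (G x))) - ln Z - ln (f x)"
    proof -
      have "ln (t x) = ln (v x) + \<beta> * ln (s x) - (ln Z + ln (f x))"
        unfolding t_def using elim sp vp Zpos by (simp add: ln_div ln_mult ln_powr)
      moreover have "ln (v x) = \<beta> * ln (u (G x))" using elim by (simp add: v_def ln_powr)
      moreover have "ln (s x) = ln (f x) - ln (F (G x))" using elim by (simp add: s_def ln_div)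
      ultimately show ?thesis by simp
    qed
    then have "ln (t x) = \<beta> * (ln (u (G x)) + ln (f x) - ln (F (G x))) - (ln Z + ln (f x))"
      by (simp add: algebra_simps)
    then have "(1 + \<alpha>) * ln (t x) = ((1 + \<alpha>) * \<beta>) * (ln (u (G x)) + ln (f x) - ln (F (G x)))
        - (1 + \<alpha>) * (ln Z + ln (f x))"
      by (simp only: right_diff_distrib mult.assoc)
    then have "(1 + \<alpha>) * ln (t x) = ln (u (G x)) + ln (f x) - ln (F (G x)) - (1 + \<alpha>) * (ln Z + ln (f x))"
      by (simp add: \<beta>(3))
    moreover have "0 < t x" unfolding t_def using elim sp vp Zpos by simp
    ultimately show ?case using elim by (simp add: ln_div algebra_simps)
  qed
  \<comment> \<open>The loss in \<open>ln t \<le> t - 1\<close>. Since \<open>\<integral> e + (\<integral> gap) / Z \<le> L / (1 + \<alpha>) + ln Z\<close>,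
    both losses vanish almost everywhere at the minimum.\<close>
  define e where "e x = t x - 1 - ln (t x)" for x
  have e_nonneg: "AE x in density M f. 0 \<le> e x"
    using lnt by eventually_elim (use ln_le_minus_one in \<open>auto simp: e_def algebra_simps\<close>)
  define l where "l x = ln (F (G x) / u (G x)) + \<alpha> * ln (f x) + (1 + \<alpha>) * ln Z" for x
  have int_l: "integrable (density M f) l" and l_eq: "(\<integral>x. l x \<partial>density M f) = L + (1 + \<alpha>) * ln Z"
    unfolding l_def[abs_def] L_def using int1 int2 by (auto simp: mass1)
  have e_l: "AE x in density M f. e x = t x - 1 + l x / (1 + \<alpha>)"
    using lnt
  proof eventually_elim
    case (elim x)
    then have "l x = (1 + \<alpha>) * (- ln (t x))"
      by (simp only: l_def mult_minus_left mult_minus_right)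
    then show ?case using \<alpha> by (simp add: e_def)
  qed
  have int_e': "integrable (density M f) (\<lambda>x. t x - 1 + l x / (1 + \<alpha>))"
    using int_t int_l by auto
  have int_e: "integrable (density M f) e"
    by (rule Bochner_Integration.integrable_cong_AE_imp[OF int_e']) (use e_l in \<open>auto simp: e_def[abs_def]\<close>)
  have "(\<integral>x. e x \<partial>density M f) = (\<integral>x. t x - 1 + l x / (1 + \<alpha>) \<partial>density M f)"
    by (rule integral_cong_AE) (use e_l in \<open>auto simp: e_def[abs_def] l_def[abs_def]\<close>)
  also have "\<dots> = (\<integral>x. v x * s x powr \<beta> \<partial>M) / Z - 1 + (L + (1 + \<alpha>) * ln Z) / (1 + \<alpha>)"
    using int_t int_l by (simp add: t_eq l_eq mass1)
  finally have e_eq: "(\<integral>x. e x \<partial>density M f) =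
      (\<integral>x. v x * s x powr \<beta> \<partial>M) / Z - 1 + (L + (1 + \<alpha>) * ln Z) / (1 + \<alpha>)" .

  assume "L \<le> - (1 + \<alpha>) * ln Z"
  then have "(L + (1 + \<alpha>) * ln Z) / (1 + \<alpha>) \<le> 0" using \<alpha> by (simp add: divide_le_0_iff algebra_simps)
  then have "(\<integral>x. e x \<partial>density M f) \<le> ((\<integral>x. v x * s x powr \<beta> \<partial>M) - Z) / Z"
    using e_eq Zpos by (simp add: diff_divide_distrib)
  also have "\<dots> \<le> - (\<integral>x. gap x \<partial>M) / Z"
    using gap_le Zpos by (intro divide_right_mono) auto
  finally have sum0: "(\<integral>x. e x \<partial>density M f) + (\<integral>x. gap x \<partial>M) / Z \<le> 0" by simp
  have "0 \<le> (\<integral>x. e x \<partial>density M f)" using e_nonneg by (rule integral_nonneg_AE)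
  moreover have "0 \<le> (\<integral>x. gap x \<partial>M) / Z" using gap_nonneg Zpos by auto
  ultimately have "(\<integral>x. e x \<partial>density M f) = 0" "(\<integral>x. gap x \<partial>M) / Z = 0" using sum0 by linarith+
  then have e0: "AE x in density M f. e x = 0" and gap0: "AE x in M. gap x = 0"
    using integral_nonneg_eq_0_iff_AE[OF int_e e_nonneg]
      integral_nonneg_eq_0_iff_AE[OF int_gap] gap_nonneg Zpos by auto
  from lnt e0 have "AE x in density M f. t x = 1"
    by eventually_elim (use ln_eq_minus_one in \<open>auto simp: e_def\<close>)
  then have t1: "AE x in M. 0 < f x \<longrightarrow> t x = 1" and Ff: "AE x in M. 0 < f x \<longrightarrow> 0 < F (G x)"
    using Fpos by (auto simp: AE_density)
  from t1 Ff gap0 supp show "AE x in M. f x = u (G x) powr (1 / (1 + \<alpha>)) / Z"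
  proof eventually_elim
    case (elim x)
    show ?case
    proof (cases "u (G x) = 0")
      case True
      then have "\<not> 0 < f x" using elim by auto
      then show ?thesis using f[of x] True by simp
    next
      case False
      then have "s x powr \<beta> = 1 - \<beta> + \<beta> * s x"
        using elim(3) u[of "G x"] by (simp add: gap_def v_def flip: right_diff_distrib)
      then have s1: "s x = 1" by (rule powr_le_affine(2)[OF s \<beta>(1,2)])
      then have "0 < f x" using f[of x] by (auto simp: s_def less_le)
      then have "t x = 1" using elim(1) by blast
      then have "v x / (Z * f x) = 1" by (simp only: t_def s1 powr_one_eq_one mult_1_right)
      then have "f x = v x / Z" using \<open>0 < f x\<close> Zpos by (simp add: field_simps)
      then show ?thesis by (simp add: v_def \<beta>_def)
    qed
  qed
qed

text \<open>The Gibbs density \<open>u(G) powr \<beta>\<close> truncated to a set \<open>A\<close> and normalized. Truncation by a set that is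
  not a union of fibres makes \<open>F\<close> inexplicit, but only the bound \<open>F \<le> u powr \<beta> / Z\<close> is needed: it
  gives the value that the untruncated density would have, with \<open>Z\<close> the mass of the truncated one.\<close>

lemma functional_truncation_bound:
  fixes u :: "'b \<Rightarrow> real" and \<alpha> :: real
  assumes M: "prob_space M" and [measurable]: "G \<in> measurable M N"
    "u \<in> borel_measurable N" "A \<in> sets M"
    and u: "\<And>y. 0 \<le> u y" and \<alpha>: "\<alpha> > 0"
    and intu: "integrable M (\<lambda>x. u (G x))"
  defines "Z \<equiv> \<integral>x. indicator A x * u (G x) powr (1 / (1 + \<alpha>)) \<partial>M"
    and "f \<equiv> \<lambda>x. indicator A x * u (G x) powr (1 / (1 + \<alpha>)) /
              (\<integral>x. indicator A x * u (G x) powr (1 / (1 + \<alpha>)) \<partial>M)"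
  defines "F \<equiv> dens (distr M N G) (distr (density M f) N G)"
  assumes Z: "Z > 0"
  shows "prob_space (density M f)"
    and "distr (density M f) N G = density (distr M N G) F"
    and "AE x in M. u (G x) = 0 \<longrightarrow> F (G x) = 0"
    and "integrable (density M f) (\<lambda>x. ln (F (G x) / u (G x)))"
    and "integrable (density M f) (\<lambda>x. ln (f x))"
    and "(\<integral>x. ln (F (G x) / u (G x)) \<partial>density M f) + \<alpha> * (\<integral>x. ln (f x) \<partial>density M f)
           \<le> - (1 + \<alpha>) * ln Z"
proof -
  interpret M: prob_space M by fact
  define \<beta> where "\<beta> = 1 / (1 + \<alpha>)"
  have \<beta>: "0 < \<beta>" "\<beta> < 1" "(1 + \<alpha>) * \<beta> = 1" using \<alpha> by (auto simp: \<beta>_def field_simps)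
  define H where "H y = u y powr \<beta> / Z" for y
  have [measurable]: "H \<in> borel_measurable N" unfolding H_def by measurable
  have H: "0 \<le> H y" for y using Z by (simp add: H_def)
  have f_eq: "f = (\<lambda>x. indicator A x * H (G x))"
    unfolding f_def Z_def[symmetric] by (simp add: H_def \<beta>_def)
  have [measurable]: "f \<in> borel_measurable M" unfolding f_eq by measurable
  have f: "0 \<le> f x" "f x \<le> H (G x)" for x using H by (auto simp: f_eq split: split_indicator)
  have "integrable M (\<lambda>x. 1 / \<beta> + u (G x) / (1 - \<beta>))" using intu by auto
  then have int_ln: "integrable M (\<lambda>x. u (G x) powr \<beta> * \<bar>ln (u (G x))\<bar>)"
    by (rule Bochner_Integration.integrable_bound)
       (auto intro!: AE_I2 order.trans[OF powr_mult_abs_ln_le[OF u \<beta>(1,2)]])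
  have int_pow: "integrable M (\<lambda>x. u (G x) powr \<beta>)"
    by (rule integrable_powr[OF M.finite_measure_axioms intu u \<beta>(1,2)])
  have int_H: "integrable M (\<lambda>x. H (G x))" unfolding H_def using int_pow by auto
  have int_f: "integrable M f"
    unfolding f_eq by (rule Bochner_Integration.integrable_bound[OF int_H]) (auto split: split_indicator)
  have "integral\<^sup>L M f = 1"
    using Z unfolding f_def Z_def by simp
  then have "(\<integral>\<^sup>+x. ennreal (f x) \<partial>M) = 1"
    using int_f f by (simp add: nn_integral_eq_integral)
  then show ps: "prob_space (density M f)"
    by (intro prob_spaceI) (simp add: emeasure_density cong: nn_integral_cong)
  interpret R: prob_space "density M f" by fact
  have mass1: "measure (density M f) (space M) = 1" using R.prob_space by simp
  have Fn: "0 \<le> F y" for y by (simp add: F_def)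
  have [measurable]: "F \<in> borel_measurable N"
    using borel_measurable_dens[of "distr M N G"] unfolding F_def by auto
  have le: "density (distr M N G) (\<lambda>y. ennreal (F y)) = distr (density M f) N G"
    "AE y in distr M N G. F y \<le> H y"
    unfolding F_def
    by (rule dens_distr_le[where H = H, OF M.finite_measure_axioms]; use f H int_H in simp)+
  show push: "distr (density M f) N G = density (distr M N G) F"
    by (rule le(1)[symmetric])
  have FH: "AE x in M. F (G x) \<le> H (G x)"
    using le(2) by (subst (asm) AE_distr_iff) auto
  then show supp: "AE x in M. u (G x) = 0 \<longrightarrow> F (G x) = 0"
    by eventually_elim (use Fn in \<open>auto simp: H_def intro: antisym\<close>)

  \<comment> \<open>An integrable majorant of both entropy integrands.\<close>
  define D where "D x = H (G x) + (u (G x) powr \<beta> * \<bar>ln (u (G x))\<bar>) / Z + H (G x) * \<bar>ln Z\<bar>" for x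
  have int_D: "integrable M D" unfolding D_def[abs_def] using int_H int_ln by auto
  have Hln: "H (G x) * (\<bar>ln (u (G x))\<bar> + \<bar>ln Z\<bar>) \<le> D x" for x
    using H[of "G x"] by (simp add: D_def H_def algebra_simps)

  have "integrable (distr (density M f) N G) (\<lambda>y. ln (F y / u y))"
    unfolding push
  proof (subst integrable_density)
    show "integrable (distr M N G) (\<lambda>y. F y *\<^sub>R ln (F y / u y))"
    proof (subst integrable_distr_eq)
      show "integrable M (\<lambda>x. F (G x) *\<^sub>R ln (F (G x) / u (G x)))"
      proof (rule Bochner_Integration.integrable_bound[OF int_D])
        show "AE x in M. norm (F (G x) *\<^sub>R ln (F (G x) / u (G x))) \<le> norm (D x)"
          using FH supp
        proof eventually_elim
          case (elim x)
          show ?case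
          proof (cases "F (G x) = 0")
            case False
            then have Fp: "F (G x) > 0" "u (G x) > 0"
              using Fn[of "G x"] elim(2) u[of "G x"] by (auto simp: less_le)
            have Hp: "H (G x) > 0" using Fp elim by linarith
            have "ln (F (G x) / u (G x)) = ln (F (G x) / H (G x)) + ((\<beta> - 1) * ln (u (G x)) - ln Z)"
            proof -
              have "ln (F (G x) / H (G x)) = ln (F (G x)) - ln (H (G x))"
                using Fp Hp by (simp add: ln_div)
              moreover have "ln (H (G x)) = \<beta> * ln (u (G x)) - ln Z"
                using Fp Z by (simp add: H_def ln_div ln_powr)
              moreover have "ln (F (G x) / u (G x)) = ln (F (G x)) - ln (u (G x))"
                using Fp by (simp add: ln_div)
              ultimately show ?thesis by (simp add: algebra_simps)
            qed
            moreover have "\<bar>(\<beta> - 1) * ln (u (G x))\<bar> \<le> \<bar>ln (u (G x))\<bar>"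
              using \<beta> by (simp add: abs_mult mult_left_le_one_le)
            ultimately have "\<bar>ln (F (G x) / u (G x))\<bar> \<le>
                \<bar>ln (F (G x) / H (G x))\<bar> + (\<bar>ln (u (G x))\<bar> + \<bar>ln Z\<bar>)" by linarith
            then have "F (G x) * \<bar>ln (F (G x) / u (G x))\<bar> \<le>
                F (G x) * \<bar>ln (F (G x) / H (G x))\<bar> + F (G x) * (\<bar>ln (u (G x))\<bar> + \<bar>ln Z\<bar>)"
              using Fp by (simp flip: distrib_left)
            also have "\<dots> \<le> H (G x) + H (G x) * (\<bar>ln (u (G x))\<bar> + \<bar>ln Z\<bar>)"
              by (intro add_mono mult_abs_ln_quotient_le mult_right_mono) (use elim Fp in auto)
            also have "\<dots> = D x" by (simp add: D_def H_def algebra_simps)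
            finally show ?thesis using Fp by (simp add: abs_mult)
          qed auto
        qed
      qed measurable
    qed auto
  qed (use Fn in auto)
  then show i1: "integrable (density M f) (\<lambda>x. ln (F (G x) / u (G x)))"
    by (subst (asm) integrable_distr_eq) auto

  have "integrable M (\<lambda>x. f x *\<^sub>R ln (f x))"
  proof (rule Bochner_Integration.integrable_bound[OF int_D])
    show "AE x in M. norm (f x *\<^sub>R ln (f x)) \<le> norm (D x)"
    proof (rule AE_I2)
      fix x
      show "norm (f x *\<^sub>R ln (f x)) \<le> norm (D x)"
      proof (cases "f x = 0")
        case False
        then have fx: "f x = H (G x)" by (auto simp: f_eq split: split_indicator_asm)
        then have up: "u (G x) > 0" using False u[of "G x"] by (auto simp: H_def less_le)
        have "ln (f x) = \<beta> * ln (u (G x)) - ln Z" unfolding fx using up Z by (simp add: H_def ln_div ln_powr)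
        moreover have "\<bar>\<beta> * ln (u (G x))\<bar> \<le> \<bar>ln (u (G x))\<bar>"
          using \<beta> by (simp add: abs_mult mult_left_le_one_le)
        ultimately have "\<bar>ln (f x)\<bar> \<le> \<bar>ln (u (G x))\<bar> + \<bar>ln Z\<bar>" by linarith
        then have "f x * \<bar>ln (f x)\<bar> \<le> H (G x) * (\<bar>ln (u (G x))\<bar> + \<bar>ln Z\<bar>)"
          unfolding fx using H by (intro mult_left_mono) auto
        also have "\<dots> \<le> D x" by (rule Hln)
        finally show ?thesis using f(1)[of x] by (simp add: abs_mult)
      qed auto
    qed
  qed measurable
  then show i2: "integrable (density M f) (\<lambda>x. ln (f x))"
    by (subst integrable_density) (use f in auto)

  have "AE y in distr (density M f) N G. 0 < F y"
    unfolding push by (simp add: AE_density)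
  then have Fpos: "AE x in density M f. 0 < F (G x)"
    by (subst (asm) AE_distr_iff) auto
  have fpos: "AE x in density M f. 0 < f x"
    by (simp add: AE_density)
  have FH': "AE x in density M f. F (G x) \<le> H (G x)"
    using FH by (auto simp: AE_density)
  \<comment> \<open>The exponent \<open>\<beta>\<close> makes the powers of \<open>u\<close> cancel: \<open>\<beta> - 1 + \<alpha> * \<beta> = 0\<close>.\<close>
  have "AE x in density M f. ln (F (G x) / u (G x)) + \<alpha> * ln (f x) \<le> - (1 + \<alpha>) * ln Z"
    using Fpos fpos FH'
  proof eventually_elim
    case (elim x)
    have fx: "f x = H (G x)" using elim by (auto simp: f_eq split: split_indicator_asm)
    then have up: "u (G x) > 0" using elim u[of "G x"] by (auto simp: H_def less_le)
    have lnH: "ln (H (G x)) = \<beta> * ln (u (G x)) - ln Z" using up Z by (simp add: H_def ln_div ln_powr)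
    have "ln (F (G x) / u (G x)) \<le> ln (H (G x)) - ln (u (G x))"
      using elim up fx by (simp add: ln_div)
    then have "ln (F (G x) / u (G x)) + \<alpha> * ln (f x) \<le> (1 + \<alpha>) * ln (H (G x)) - ln (u (G x))"
      by (simp add: fx algebra_simps)
    also have "\<dots> = ((1 + \<alpha>) * \<beta>) * ln (u (G x)) - (1 + \<alpha>) * ln Z - ln (u (G x))"
      unfolding lnH by (simp add: algebra_simps)
    also have "\<dots> = - (1 + \<alpha>) * ln Z" unfolding \<beta>(3) by (simp add: algebra_simps)
    finally show ?case .
  qed
  then have "(\<integral>x. ln (F (G x) / u (G x)) + \<alpha> * ln (f x) \<partial>density M f) \<le>
      (\<integral>x. - (1 + \<alpha>) * ln Z \<partial>density M f)"
    using i1 i2 by (intro integral_mono_AE) auto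
  then show "(\<integral>x. ln (F (G x) / u (G x)) \<partial>density M f) + \<alpha> * (\<integral>x. ln (f x) \<partial>density M f)
           \<le> - (1 + \<alpha>) * ln Z"
    using i1 i2 mass1 by simp
qed

section \<open>The loss in terms of densities\<close>

text \<open>Here \<open>N\<close> stands for the pushforward of \<open>M\<close> and \<open>P\<close> for that of \<open>\<rho>\<close>. By the chain rule for densities,
  \<open>dP/dQ = F / u\<close> holds \<open>P\<close>-almost everywhere. Where \<open>dens \<Lambda> N\<close> vanishes, \<open>u\<close> has the default value
  \<open>0\<close>; that set is null for \<open>N\<close>, so it does not disturb the description of absolute continuity.\<close>

lemma KL_density_quotient:
  fixes F :: "'a \<Rightarrow> real"
  assumes \<Lambda>: "sigma_finite_measure \<Lambda>"
    and N: "prob_space N" "sets N = sets \<Lambda>" "absolutely_continuous \<Lambda> N"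
    and Q: "prob_space Q" "sets Q = sets \<Lambda>" "absolutely_continuous \<Lambda> Q"
    and F: "F \<in> borel_measurable \<Lambda>" "\<And>y. 0 \<le> F y" and P: "P = density N F" "prob_space P"
  defines "u \<equiv> \<lambda>y. dens \<Lambda> Q y / dens \<Lambda> N y"
  shows "KL P Q = (if (AE y in N. u y = 0 \<longrightarrow> F y = 0) \<and> integrable P (\<lambda>y. ln (F y / u y))
     then ereal (\<integral>y. ln (F y / u y) \<partial>P) else \<infinity>)"
proof -
  interpret N: prob_space N by fact
  interpret Q: prob_space Q by fact
  interpret P: prob_space P by fact
  note F(1)[measurable]
  have [measurable_cong]: "sets N = sets \<Lambda>" "sets Q = sets \<Lambda>" "sets P = sets \<Lambda>"
    using N Q P by auto
  define p where "p = dens \<Lambda> Q"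
  define m where "m = dens \<Lambda> N"
  have [measurable]: "p \<in> borel_measurable \<Lambda>" "m \<in> borel_measurable \<Lambda>" by (auto simp: p_def m_def)
  have [measurable]: "u \<in> borel_measurable \<Lambda>"
    unfolding u_def by measurable
  have pm: "0 \<le> p y" "0 \<le> m y" "u y = p y / m y" for y by (auto simp: p_def m_def u_def)
  have Qp: "Q = density \<Lambda> p" unfolding p_def
    by (rule density_dens[symmetric]) (use \<Lambda> Q Q.finite_measure_axioms in auto)
  have Nm: "N = density \<Lambda> m" unfolding m_def
    by (rule density_dens[symmetric]) (use \<Lambda> N N.finite_measure_axioms in auto)
  have acNP: "absolutely_continuous N P" unfolding P by (rule absolutely_continuousI_density) simp
  have mpos: "AE y in N. 0 < m y" unfolding Nm by (simp add: AE_density)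
  have ac_iff: "absolutely_continuous Q P \<longleftrightarrow> (AE y in N. u y = 0 \<longrightarrow> F y = 0)"
  proof
    assume ac: "absolutely_continuous Q P"
    have "AE y in Q. 0 < p y" unfolding Qp by (simp add: AE_density)
    then have "AE y in P. 0 < p y" by (rule absolutely_continuous_AE[rotated 2]) (use ac in \<open>auto simp: \<open>sets P = sets \<Lambda>\<close> Q\<close>)
    then have "AE y in N. 0 < F y \<longrightarrow> 0 < p y" unfolding P by (simp add: AE_density)
    with mpos show "AE y in N. u y = 0 \<longrightarrow> F y = 0"
      by eventually_elim (use F(2) in \<open>auto simp: pm less_le\<close>)
  next
    assume u0: "AE y in N. u y = 0 \<longrightarrow> F y = 0"
    show "absolutely_continuous Q P"
      unfolding absolutely_continuous_def
    proof
      fix X assume "X \<in> null_sets Q"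
      then have X: "X \<in> sets \<Lambda>" "AE y in \<Lambda>. y \<in> X \<longrightarrow> p y = 0"
        unfolding Qp using pm(1) by (auto simp: null_sets_density_iff ennreal_eq_0_iff intro: antisym)
      from X(2) have "AE y in N. y \<in> X \<longrightarrow> p y = 0"
        by (rule absolutely_continuous_AE[rotated 2]) (use N in auto)
      with u0 have "AE y in N. y \<in> X \<longrightarrow> F y = 0" by eventually_elim (auto simp: pm)
      then show "X \<in> null_sets P"
        unfolding P using X(1) by (auto simp: null_sets_density_iff N)
    qed
  qed
  have eq: "AE y in P. entropy_density (exp 1) Q P y = ln (F y / u y)"
    if ac: "absolutely_continuous Q P"
  proof -
    define q where "q = dens Q P"
    have [measurable]: "q \<in> borel_measurable \<Lambda>"
      using borel_measurable_dens[of Q P] by (simp add: q_def)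
    have "P = density Q q" unfolding q_def
      by (rule density_dens[symmetric])
         (use ac Q.sigma_finite_measure_axioms P.finite_measure_axioms \<open>sets P = sets \<Lambda>\<close> Q in auto)
    then have "P = density \<Lambda> (\<lambda>y. ennreal (p y * q y))"
      unfolding Qp by (simp add: density_density_eq ennreal_mult' pm)
    moreover have "P = density \<Lambda> (\<lambda>y. ennreal (m y * F y))"
      unfolding P Nm by (simp add: density_density_eq ennreal_mult' pm)
    ultimately have "AE y in \<Lambda>. ennreal (p y * q y) = ennreal (m y * F y)"
      by (intro sigma_finite_measure.density_unique[OF \<Lambda>]) auto
    then have "AE y in \<Lambda>. p y * q y = m y * F y"
      by eventually_elim (use pm F(2) in \<open>auto simp: q_def\<close>)
    then have "AE y in N. p y * q y = m y * F y"
      by (rule absolutely_continuous_AE[rotated 2]) (use N in auto)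
    then have "AE y in N. 0 < F y \<longrightarrow> q y = F y / u y"
      using mpos ac[unfolded ac_iff]
    proof eventually_elim
      case (elim y)
      show ?case
      proof
        assume "0 < F y"
        then have "p y \<noteq> 0" using elim by (auto simp: pm)
        then show "q y = F y / u y" using elim by (simp add: pm field_simps)
      qed
    qed
    then have "AE y in P. q y = F y / u y" unfolding P by (simp add: AE_density)
    then show ?thesis
      by eventually_elim (simp add: entropy_density_def q_def dens_def log_def)
  qed
  have [measurable]: "entropy_density (exp 1) Q P \<in> borel_measurable P"
    using measurable_entropy_density[of "exp 1" Q P] by simp
  have [measurable]: "(\<lambda>y. ln (F y / u y)) \<in> borel_measurable P" by measurable
  show ?thesis
  proof (cases "absolutely_continuous Q P")
    case True
    have "integrable P (entropy_density (exp 1) Q P) \<longleftrightarrow> integrable P (\<lambda>y. ln (F y / u y))"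
      by (rule integrable_cong_AE) (use eq[OF True] in auto)
    moreover have "KL_divergence (exp 1) Q P = (\<integral>y. ln (F y / u y) \<partial>P)"
      unfolding KL_divergence_def by (rule integral_cong_AE) (use eq[OF True] in auto)
    ultimately show ?thesis using True ac_iff by (simp add: KL_def)
  qed (simp add: KL_def ac_iff)
qed

lemma P_ac_D:
  assumes "\<rho> \<in> P_ac \<Theta>"
  shows "prob_space \<rho>" "sets \<rho> = sets (leb_on \<Theta>)" "absolutely_continuous (leb_on \<Theta>) \<rho>"
  using assms by (auto simp: P_ac_def)

lemma sigma_finite_leb_on: "\<Theta> \<in> sets borel \<Longrightarrow> sigma_finite_measure (leb_on \<Theta>)"
  by (rule sigma_finite_measure_restrict_space) (auto intro: lborel.sigma_finite_measure_axioms)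

lemma density_dens_leb_on:
  assumes "\<Theta> \<in> sets borel" "\<rho> \<in> P_ac \<Theta>"
  shows "density (leb_on \<Theta>) (\<lambda>x. ennreal (dens (leb_on \<Theta>) \<rho> x)) = \<rho>"
  using P_ac_D[OF assms(2)] sigma_finite_leb_on[OF assms(1)]
  by (intro density_dens) (auto intro: prob_space.finite_measure)

lemma dens_leb_on_density:
  fixes f :: "real ^ 'm \<Rightarrow> real"
  assumes \<Theta>: "\<Theta> \<in> sets borel" and M: "M \<in> P_ac \<Theta>"
    and f: "f \<in> borel_measurable M" "\<And>x. 0 \<le> f x"
  shows "AE x in leb_on \<Theta>. dens (leb_on \<Theta>) (density M f) x = dens (leb_on \<Theta>) M x * f x"
proof (rule dens_unique[OF sigma_finite_leb_on[OF \<Theta>]])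
  have [measurable]: "f \<in> borel_measurable (leb_on \<Theta>)"
    using f(1) P_ac_D(2)[OF M] by (simp cong: measurable_cong_sets)
  show "(\<lambda>x. dens (leb_on \<Theta>) M x * f x) \<in> borel_measurable (leb_on \<Theta>)" by measurable
  show "0 \<le> dens (leb_on \<Theta>) M x * f x" for x using f by simp
  have "density (leb_on \<Theta>) (\<lambda>x. ennreal (dens (leb_on \<Theta>) M x * f x)) =
      density (density (leb_on \<Theta>) (\<lambda>x. ennreal (dens (leb_on \<Theta>) M x))) f"
    by (simp add: density_density_eq ennreal_mult f)
  then show "density (leb_on \<Theta>) (\<lambda>x. ennreal (dens (leb_on \<Theta>) M x * f x)) = density M f"
    using density_dens_leb_on[OF \<Theta> M] by simp
qed

lemma reg_density:
  fixes f :: "real ^ 'm \<Rightarrow> real"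
  assumes \<Theta>: "\<Theta> \<in> sets borel" and M: "M \<in> P_ac \<Theta>"
    and f: "f \<in> borel_measurable M" "\<And>x. 0 \<le> f x"
  shows "reg \<Theta> M (density M f) = (if integrable (density M f) (\<lambda>x. ln (f x))
     then ereal (\<integral>x. ln (f x) \<partial>density M f) else \<infinity>)"
proof -
  let ?L = "leb_on \<Theta>"
  let ?g = "\<lambda>x. ln (dens ?L (density M f) x / dens ?L M x) * dens ?L (density M f) x"
  let ?h = "\<lambda>x. dens ?L M x *\<^sub>R (f x *\<^sub>R ln (f x))"
  note f(1)[measurable]
  have fL[measurable]: "f \<in> borel_measurable ?L"
    using f(1) P_ac_D(2)[OF M] by (simp cong: measurable_cong_sets)
  have gh: "AE x in ?L. ?g x = ?h x"
    using dens_leb_on_density[OF \<Theta> M f]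
    by eventually_elim (auto simp: f)
  have "integrable ?L ?g \<longleftrightarrow> integrable ?L ?h"
    by (rule integrable_cong_AE[OF _ _ gh]) auto
  also have "\<dots> \<longleftrightarrow> integrable (density ?L (dens ?L M)) (\<lambda>x. f x *\<^sub>R ln (f x))"
    by (rule integrable_density[symmetric]) auto
  also have "\<dots> \<longleftrightarrow> integrable (density M f) (\<lambda>x. ln (f x))"
    unfolding density_dens_leb_on[OF \<Theta> M] by (rule integrable_density[symmetric]) (use f in auto)
  finally have 1: "integrable ?L ?g \<longleftrightarrow> integrable (density M f) (\<lambda>x. ln (f x))" .
  have "integral\<^sup>L ?L ?g = integral\<^sup>L ?L ?h"
    by (rule integral_cong_AE[OF _ _ gh]) auto
  also have "\<dots> = integral\<^sup>L (density ?L (dens ?L M)) (\<lambda>x. f x *\<^sub>R ln (f x))"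
    by (rule integral_density[symmetric]) auto
  also have "\<dots> = integral\<^sup>L (density M f) (\<lambda>x. ln (f x))"
    unfolding density_dens_leb_on[OF \<Theta> M] by (rule integral_density[symmetric]) (use f in auto)
  finally have 2: "integral\<^sup>L ?L ?g = integral\<^sup>L (density M f) (\<lambda>x. ln (f x))" .
  have "absolutely_continuous M (density M f)" by (rule absolutely_continuousI_density) simp
  then show ?thesis unfolding reg_def Let_def using 1 2 by simp
qed

lemma loss_density:
  fixes G :: "real ^ 'm \<Rightarrow> real ^ 'n" and f :: "real ^ 'm \<Rightarrow> real" and F :: "real ^ 'n \<Rightarrow> real"
  assumes \<Theta>: "\<Theta> \<in> sets borel" and M: "M \<in> P_ac \<Theta>" and G: "G \<in> borel_measurable M"
    and \<rho>y: "prob_space \<rho>y" "sets \<rho>y = sets borel" "absolutely_continuous lborel \<rho>y"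
    and GM: "absolutely_continuous lborel (distr M borel G)"
    and f: "f \<in> borel_measurable M" "\<And>x. 0 \<le> f x" "prob_space (density M f)"
    and F: "F \<in> borel_measurable borel" "\<And>y. 0 \<le> F y"
    and push: "distr (density M f) borel G = density (distr M borel G) F"
    and \<alpha>: "\<alpha> > 0"
  defines "u \<equiv> \<lambda>y. dens lborel \<rho>y y / dens lborel (distr M borel G) y"
  shows "loss \<Theta> G M \<rho>y \<alpha> (density M f) =
    (if (AE x in M. u (G x) = 0 \<longrightarrow> F (G x) = 0) \<and>
        integrable (density M f) (\<lambda>x. ln (F (G x) / u (G x))) \<and>
        integrable (density M f) (\<lambda>x. ln (f x))
     then ereal ((\<integral>x. ln (F (G x) / u (G x)) \<partial>density M f) + \<alpha> * (\<integral>x. ln (f x) \<partial>density M f))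
     else \<infinity>)"
proof -
  note G[measurable] F(1)[measurable]
  have [measurable]: "u \<in> borel_measurable borel"
    using borel_measurable_dens[of lborel \<rho>y] borel_measurable_dens[of lborel "distr M borel G"]
    unfolding u_def by simp
  have ps: "prob_space (distr M borel G)" "prob_space (distr (density M f) borel G)"
    using G by (auto intro!: prob_space.prob_space_distr P_ac_D(1)[OF M] f(3))
  have "KL (distr (density M f) borel G) \<rho>y =
      (if (AE y in distr M borel G. u y = 0 \<longrightarrow> F y = 0) \<and>
        integrable (distr (density M f) borel G) (\<lambda>y. ln (F y / u y))
       then ereal (\<integral>y. ln (F y / u y) \<partial>distr (density M f) borel G) else \<infinity>)"
    unfolding u_def
    by (rule KL_density_quotient) (use \<rho>y GM F push ps lborel.sigma_finite_measure_axioms in auto)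
  moreover have "(AE y in distr M borel G. u y = 0 \<longrightarrow> F y = 0) \<longleftrightarrow> (AE x in M. u (G x) = 0 \<longrightarrow> F (G x) = 0)"
    by (subst AE_distr_iff) auto
  moreover have "integrable (distr (density M f) borel G) (\<lambda>y. ln (F y / u y)) \<longleftrightarrow>
      integrable (density M f) (\<lambda>x. ln (F (G x) / u (G x)))"
    by (subst integrable_distr_eq) auto
  moreover have "(\<integral>y. ln (F y / u y) \<partial>distr (density M f) borel G) =
      (\<integral>x. ln (F (G x) / u (G x)) \<partial>density M f)"
    by (subst integral_distr) auto
  ultimately show ?thesis
    unfolding loss_def reg_density[OF \<Theta> M f(1,2)] using \<alpha> by auto
qed

text \<open>Only an inequality, because \<open>Q\<close> may charge the set where the density of \<open>N\<close> vanishes.\<close>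

lemma nn_integral_density_quotient_le:
  assumes \<Lambda>: "sigma_finite_measure \<Lambda>"
    and N: "finite_measure N" "sets N = sets \<Lambda>" "absolutely_continuous \<Lambda> N"
    and Q: "finite_measure Q" "sets Q = sets \<Lambda>" "absolutely_continuous \<Lambda> Q"
  shows "(\<integral>\<^sup>+y. ennreal (dens \<Lambda> Q y / dens \<Lambda> N y) \<partial>N) \<le> emeasure Q (space Q)"
proof -
  have [measurable_cong]: "sets N = sets \<Lambda>" by fact
  have "(\<integral>\<^sup>+y. ennreal (dens \<Lambda> Q y / dens \<Lambda> N y) \<partial>N) =
      (\<integral>\<^sup>+y. ennreal (dens \<Lambda> Q y / dens \<Lambda> N y) \<partial>density \<Lambda> (dens \<Lambda> N))"
    using density_dens[OF \<Lambda> N] by simp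
  also have "\<dots> = (\<integral>\<^sup>+y. ennreal (dens \<Lambda> N y * (dens \<Lambda> Q y / dens \<Lambda> N y)) \<partial>\<Lambda>)"
    by (subst nn_integral_density) (auto simp: ennreal_mult[symmetric] intro!: nn_integral_cong)
  also have "\<dots> \<le> (\<integral>\<^sup>+y. ennreal (dens \<Lambda> Q y) \<partial>\<Lambda>)"
    by (intro nn_integral_mono ennreal_leI) auto
  also have "\<dots> = emeasure (density \<Lambda> (dens \<Lambda> Q)) (space \<Lambda>)"
    by (simp add: emeasure_density cong: nn_integral_cong)
  also have "\<dots> = emeasure Q (space Q)"
    using density_dens[OF \<Lambda> Q] sets_eq_imp_space_eq[OF Q(2)] by simp
  finally show ?thesis .
qed

section \<open>The minimizer\<close>

text \<open>The Gibbs density need not have a finite second moment, so it cannot be used as a competitor.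
  Its truncations to balls can, and their losses are bounded by values converging to the lower
  bound \<open>- (1 + \<alpha>) * ln Z\<close>. A minimizer therefore attains the lower bound, and the equality case
  identifies it.\<close>

lemma minimizer_density:
  fixes G :: "real ^ 'm \<Rightarrow> real ^ 'n"
  assumes \<Theta>: "\<Theta> \<in> sets borel" and M: "M \<in> P_ac \<Theta>"
    and Gm: "G \<in> borel_measurable (restrict_space borel \<Theta>)"
    and \<rho>y: "prob_space \<rho>y" "sets \<rho>y = sets borel" "absolutely_continuous lborel \<rho>y"
    and GM: "absolutely_continuous lborel (distr M borel G)"
    and \<alpha>: "\<alpha> > 0" and min: "minimizer \<Theta> G M \<rho>y \<alpha> \<rho>"
  defines "u \<equiv> \<lambda>y. dens lborel \<rho>y y / dens lborel (distr M borel G) y"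
  shows "\<exists>Z>0. \<rho> = density M (\<lambda>x. ennreal (u (G x) powr (1 / (1 + \<alpha>)) / Z))"
proof -
  interpret M: prob_space M by (rule P_ac_D[OF M])
  interpret Y: prob_space \<rho>y by fact
  have sM: "sets M = sets (restrict_space borel \<Theta>)"
    using P_ac_D(2)[OF M] by (simp cong: sets_restrict_space_cong)
  have spM: "space M = \<Theta>" using sets_eq_imp_space_eq[OF sM] by (simp add: space_restrict_space)
  have G[measurable]: "G \<in> borel_measurable M" using Gm sM by (simp cong: measurable_cong_sets)
  interpret GM: prob_space "distr M borel G" by (rule M.prob_space_distr) simp
  have um[measurable]: "u \<in> borel_measurable borel"
    using borel_measurable_dens[of lborel \<rho>y] borel_measurable_dens[of lborel "distr M borel G"]
    unfolding u_def by simp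
  have u: "0 \<le> u y" for y by (simp add: u_def)
  have "(\<integral>\<^sup>+y. ennreal (u y) \<partial>distr M borel G) \<le> emeasure \<rho>y (space \<rho>y)"
    unfolding u_def
    by (rule nn_integral_density_quotient_le)
       (use \<rho>y GM lborel.sigma_finite_measure_axioms GM.finite_measure_axioms Y.finite_measure_axioms in auto)
  then have "(\<integral>\<^sup>+x. ennreal (u (G x)) \<partial>M) < \<infinity>"
    by (simp add: nn_integral_distr Y.emeasure_space_1 order.strict_trans1[OF _ ennreal_one_less_top])
  then have intu: "integrable M (\<lambda>x. u (G x))"
    by (intro integrableI_nonneg) (use u in auto)
  define \<beta> where "\<beta> = 1 / (1 + \<alpha>)"
  have \<beta>: "0 < \<beta>" "\<beta> < 1" using \<alpha> by (auto simp: \<beta>_def field_simps)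
  have intZ: "integrable M (\<lambda>x. u (G x) powr \<beta>)"
    by (rule integrable_powr[OF M.finite_measure_axioms intu u \<beta>])
  define Z where "Z = (\<integral>x. u (G x) powr \<beta> \<partial>M)"

  have P2: "\<rho> \<in> P2_ac \<Theta>" and fin: "loss \<Theta> G M \<rho>y \<alpha> \<rho> < \<infinity>"
    and least: "\<And>\<rho>'. \<rho>' \<in> P2_ac \<Theta> \<Longrightarrow> loss \<Theta> G M \<rho>y \<alpha> \<rho> \<le> loss \<Theta> G M \<rho>y \<alpha> \<rho>'"
    using min by (auto simp: minimizer_def is_arg_min_def not_less)
  have ac\<rho>: "\<rho> \<in> P_ac \<Theta>" using P2 by (simp add: P2_ac_def)
  interpret R: prob_space \<rho> by (rule P_ac_D[OF ac\<rho>])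
  have s\<rho>: "sets \<rho> = sets M" using P_ac_D(2)[OF ac\<rho>] P_ac_D(2)[OF M] by simp
  have acM\<rho>: "absolutely_continuous M \<rho>"
  proof (rule ccontr)
    assume "\<not> ?thesis"
    then have "reg \<Theta> M \<rho> = \<infinity>" by (simp add: reg_def Let_def)
    moreover have "KL (distr \<rho> borel G) \<rho>y \<noteq> - \<infinity>" by (simp add: KL_def)
    ultimately show False using fin \<alpha> by (simp add: loss_def)
  qed
  define f where "f = dens M \<rho>"
  have [measurable]: "f \<in> borel_measurable M" and f: "0 \<le> f x" for x by (auto simp: f_def)
  have \<rho>f: "\<rho> = density M f" unfolding f_def
    by (rule density_dens[symmetric])
       (use M.sigma_finite_measure_axioms R.finite_measure_axioms s\<rho> acM\<rho> in auto)
  have [measurable]: "G \<in> borel_measurable \<rho>" by (simp add: \<rho>f)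
  interpret GR: prob_space "distr \<rho> borel G" by (rule R.prob_space_distr) simp
  define F where "F = dens (distr M borel G) (distr \<rho> borel G)"
  have [measurable]: "F \<in> borel_measurable borel"
    using borel_measurable_dens[of "distr M borel G"] by (simp add: F_def)
  have F: "0 \<le> F y" for y by (simp add: F_def)
  have push: "distr (density M f) borel G = density (distr M borel G) F"
    unfolding \<rho>f[symmetric] F_def
    by (rule density_dens[symmetric])
       (use GM.sigma_finite_measure_axioms GR.finite_measure_axioms
          absolutely_continuous_distr[OF acM\<rho> s\<rho> G] in auto)
  have psf: "prob_space (density M f)" using R.prob_space_axioms by (simp add: \<rho>f)
  define L where "L = (\<integral>x. ln (F (G x) / u (G x)) \<partial>density M f) + \<alpha> * (\<integral>x. ln (f x) \<partial>density M f)"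
  have lossL: "AE x in M. u (G x) = 0 \<longrightarrow> F (G x) = 0"
      "integrable (density M f) (\<lambda>x. ln (F (G x) / u (G x)))"
      "integrable (density M f) (\<lambda>x. ln (f x))"
      "loss \<Theta> G M \<rho>y \<alpha> \<rho> = ereal L"
    using fin loss_density[OF \<Theta> M G \<rho>y GM _ f psf _ F push \<alpha>] unfolding L_def u_def \<rho>f[symmetric]
    by (auto split: if_splits)
  note lower = functional_at_lower_bound[OF M.prob_space_axioms G _ _ um f F u psf push lossL(1) \<alpha> _ lossL(2,3),
      folded \<beta>_def, folded Z_def L_def]
  have Zpos: "Z > 0" by (rule lower(1)) (use intZ in auto)

  define A where "A n = \<Theta> \<inter> cball 0 (real n)" for n
  have A: "A n \<in> sets M" for n using \<Theta> by (auto simp: A_def sM sets_restrict_space)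
  define Zn where "Zn n = (\<integral>x. indicator (A n) x * u (G x) powr \<beta> \<partial>M)" for n
  have "(\<lambda>n. \<integral>x. indicator (A n) x * u (G x) powr \<beta> \<partial>M) \<longlonglongrightarrow> (\<integral>x. u (G x) powr \<beta> \<partial>M)"
  proof (rule integral_dominated_convergence[where w = "\<lambda>x. u (G x) powr \<beta>"])
    show "AE x in M. (\<lambda>n. indicator (A n) x * u (G x) powr \<beta>) \<longlonglongrightarrow> u (G x) powr \<beta>"
    proof (rule AE_I2)
      fix x assume "x \<in> space M"
      have "eventually (\<lambda>n. real n \<ge> norm x) sequentially"
        using filterlim_real_sequentially by (auto simp: filterlim_at_top)
      then have "eventually (\<lambda>n. indicator (A n) x * u (G x) powr \<beta> = u (G x) powr \<beta>) sequentially"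
        by eventually_elim (use \<open>x \<in> space M\<close> in \<open>auto simp: A_def spM\<close>)
      then show "(\<lambda>n. indicator (A n) x * u (G x) powr \<beta>) \<longlonglongrightarrow> u (G x) powr \<beta>"
        by (rule tendsto_eventually)
    qed
  qed (use A intZ in \<open>auto split: split_indicator\<close>)
  then have Zlim: "Zn \<longlonglongrightarrow> Z" by (simp add: Zn_def[abs_def] Z_def)
  have L_le: "L \<le> - (1 + \<alpha>) * ln (Zn n)" if "Zn n > 0" for n
  proof -
    define fn where "fn x = indicator (A n) x * u (G x) powr \<beta> / Zn n" for x
    define Fn where "Fn = dens (distr M borel G) (distr (density M fn) borel G)"
    note A[of n, measurable]
    have fnm[measurable]: "fn \<in> borel_measurable M" unfolding fn_def by measurable
    have fn: "0 \<le> fn x" for x using that by (simp add: fn_def)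
    have Fnm: "Fn \<in> borel_measurable borel"
      using borel_measurable_dens[of "distr M borel G"] by (simp add: Fn_def)
    have Fn: "0 \<le> Fn y" for y by (simp add: Fn_def)
    note tr = functional_truncation_bound[OF M.prob_space_axioms G um A[of n] u \<alpha> intu,
        folded \<beta>_def, folded Zn_def, OF that, folded fn_def, folded Fn_def]
    have "absolutely_continuous (leb_on \<Theta>) (density M fn)"
      using P_ac_D(3)[OF M] absolutely_continuousI_density[of fn M]
      unfolding absolutely_continuous_def by (auto simp: absolutely_continuousI_density)
    then have "density M fn \<in> P_ac \<Theta>" using tr(1) P_ac_D(2)[OF M] by (simp add: P_ac_def)
    moreover have "integrable (density M fn) (\<lambda>x. (norm x)\<^sup>2)"
    proof (rule finite_measure.integrable_const_bound[where B = "(real n)\<^sup>2"])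
      show "AE x in density M fn. norm ((norm x)\<^sup>2) \<le> (real n)\<^sup>2"
        unfolding AE_density[OF measurable_compose[OF fnm measurable_ennreal]]
      proof (intro AE_I2 impI)
        fix x assume "0 < ennreal (fn x)"
        then have "x \<in> A n" by (auto simp: fn_def split: split_indicator_asm)
        then have "norm x \<le> real n" by (simp add: A_def)
        then show "norm ((norm x)\<^sup>2) \<le> (real n)\<^sup>2" by (simp add: power_mono)
      qed
      show "(\<lambda>x. (norm x)\<^sup>2) \<in> borel_measurable (density M fn)"
        using sM by (simp add: measurable_restrict_space1 cong: measurable_cong_sets)
    qed (use tr(1) in \<open>simp add: prob_space.finite_measure\<close>)
    ultimately have "density M fn \<in> P2_ac \<Theta>" by (simp add: P2_ac_def)
    then have "ereal L \<le> loss \<Theta> G M \<rho>y \<alpha> (density M fn)" using least lossL(4) by metis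
    also have "\<dots> = ereal ((\<integral>x. ln (Fn (G x) / u (G x)) \<partial>density M fn) + \<alpha> * (\<integral>x. ln (fn x) \<partial>density M fn))"
      using loss_density[OF \<Theta> M G \<rho>y GM fnm fn tr(1) Fnm Fn tr(2) \<alpha>] tr(3-5)
      unfolding u_def by simp
    also have "\<dots> \<le> ereal (- (1 + \<alpha>) * ln (Zn n))" using tr(6) by simp
    finally show ?thesis by simp
  qed
  have "L \<le> - (1 + \<alpha>) * ln Z"
  proof (rule tendsto_lowerbound)
    show "(\<lambda>n. - (1 + \<alpha>) * ln (Zn n)) \<longlonglongrightarrow> - (1 + \<alpha>) * ln Z"
      using Zlim Zpos by (intro tendsto_intros) auto
    have "eventually (\<lambda>n. Zn n > 0) sequentially" using order_tendstoD(1)[OF Zlim Zpos] .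
    then show "eventually (\<lambda>n. L \<le> - (1 + \<alpha>) * ln (Zn n)) sequentially"
      by eventually_elim (rule L_le)
  qed simp
  then have "AE x in M. f x = u (G x) powr \<beta> / Z"
    by (intro lower(2)) (use intZ in auto)
  then have "\<rho> = density M (\<lambda>x. ennreal (u (G x) powr \<beta> / Z))"
    unfolding \<rho>f by (intro density_cong) auto
  then show ?thesis using Zpos by (auto simp: \<beta>_def)
qed

theorem theorem4p1:
  fixes \<Theta> :: "(real ^ 'm) set" and G :: "real ^ 'm \<Rightarrow> real ^ 'n"
    and M :: "(real ^ 'm) measure" and \<rho>y :: "(real ^ 'n) measure"
  assumes "\<Theta> \<in> sets borel"
    and "G \<in> borel_measurable (restrict_space borel \<Theta>)"
    and "M \<in> P_ac \<Theta>"
    and "prob_space \<rho>y" and "sets \<rho>y = sets borel" and "absolutely_continuous lborel \<rho>y"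
    and "absolutely_continuous lborel (distr M borel G)"
  shows "\<exists>g :: real \<Rightarrow> real ^ 'n \<Rightarrow> real. \<forall>\<alpha> > 0. \<forall>\<rho>. minimizer \<Theta> G M \<rho>y \<alpha> \<rho> \<longrightarrow>
     (\<forall>\<kappa>\<^sub>\<rho> \<kappa>\<^sub>M. disintegration \<Theta> G \<rho> \<kappa>\<^sub>\<rho> \<longrightarrow> disintegration \<Theta> G M \<kappa>\<^sub>M \<longrightarrow>
        (AE y in distr \<rho> borel G. y \<in> G ` \<Theta> \<longrightarrow>
           absolutely_continuous (\<kappa>\<^sub>M y) (\<kappa>\<^sub>\<rho> y) \<and>
           (AE x in \<kappa>\<^sub>M y. RN_deriv (\<kappa>\<^sub>M y) (\<kappa>\<^sub>\<rho> y) x = ennreal (g \<alpha> y)))) \<and>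
     (\<exists>c > 0. AE x in leb_on \<Theta>. dens (leb_on \<Theta>) \<rho> x =
        c * (dens (leb_on \<Theta>) M x *
             (dens lborel \<rho>y (G x) / dens lborel (distr M borel G) (G x)) powr (1 / (1 + \<alpha>))))"
  \<comment> \<open>Conditional distributions are normalized, so two that are proportional are equal and the
    constant is \<open>1\<close>.\<close>
proof (intro exI[of _ "\<lambda>_ _. 1"] allI impI)
  fix \<alpha> :: real and \<rho>
  assume \<alpha>: "\<alpha> > 0" and min: "minimizer \<Theta> G M \<rho>y \<alpha> \<rho>"
  define u where "u y = dens lborel \<rho>y y / dens lborel (distr M borel G) y" for y
  obtain Z where Z: "Z > 0" and \<rho>: "\<rho> = density M (\<lambda>x. ennreal (u (G x) powr (1 / (1 + \<alpha>)) / Z))"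
    using minimizer_density[OF assms(1,3,2,4-7) \<alpha> min] unfolding u_def by blast
  have sM: "sets M = sets (restrict_space borel \<Theta>)"
    using P_ac_D(2)[OF assms(3)] by (simp cong: sets_restrict_space_cong)
  have [measurable]: "G \<in> borel_measurable M" using assms(2) sM by (simp cong: measurable_cong_sets)
  have [measurable]: "u \<in> borel_measurable borel"
    using borel_measurable_dens[of lborel \<rho>y] borel_measurable_dens[of lborel "distr M borel G"]
    unfolding u_def[abs_def] by simp
  have ps: "prob_space \<rho>"
    using min by (auto simp: minimizer_def is_arg_min_def P2_ac_def P_ac_def)
  show "(\<forall>\<kappa>\<^sub>\<rho> \<kappa>\<^sub>M. disintegration \<Theta> G \<rho> \<kappa>\<^sub>\<rho> \<longrightarrow> disintegration \<Theta> G M \<kappa>\<^sub>M \<longrightarrow>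
        (AE y in distr \<rho> borel G. y \<in> G ` \<Theta> \<longrightarrow>
           absolutely_continuous (\<kappa>\<^sub>M y) (\<kappa>\<^sub>\<rho> y) \<and>
           (AE x in \<kappa>\<^sub>M y. RN_deriv (\<kappa>\<^sub>M y) (\<kappa>\<^sub>\<rho> y) x = ennreal 1))) \<and>
     (\<exists>c > 0. AE x in leb_on \<Theta>. dens (leb_on \<Theta>) \<rho> x =
        c * (dens (leb_on \<Theta>) M x *
             (dens lborel \<rho>y (G x) / dens lborel (distr M borel G) (G x)) powr (1 / (1 + \<alpha>))))"
  proof (intro conjI allI impI)
    fix \<kappa> \<kappa>' assume dis: "disintegration \<Theta> G \<rho> \<kappa>" "disintegration \<Theta> G M \<kappa>'"
    have "AE y in distr \<rho> borel G. \<kappa> y = \<kappa>' y"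
      by (rule disintegration_fibrewise_reweighting[OF assms(1,2) sM _ _ ps dis,
            where h = "\<lambda>y. ennreal (u y powr (1 / (1 + \<alpha>)) / Z)"]) (use \<rho> in auto)
    then show "AE y in distr \<rho> borel G. y \<in> G ` \<Theta> \<longrightarrow>
           absolutely_continuous (\<kappa>' y) (\<kappa> y) \<and> (AE x in \<kappa>' y. RN_deriv (\<kappa>' y) (\<kappa> y) x = ennreal 1)"
    proof eventually_elim
      case (elim y)
      interpret K: prob_space "\<kappa>' y" by (rule disintegration_kernel[OF dis(2)])
      have "AE x in \<kappa>' y. 1 = RN_deriv (\<kappa>' y) (\<kappa>' y) x"
        by (rule K.RN_deriv_unique) (auto simp: density_1)
      then show ?case unfolding elim by (auto simp: absolutely_continuous_def)
    qed
  next
    have "AE x in leb_on \<Theta>. dens (leb_on \<Theta>) \<rho> x =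
        dens (leb_on \<Theta>) M x * (u (G x) powr (1 / (1 + \<alpha>)) / Z)"
      unfolding \<rho> by (rule dens_leb_on_density[OF assms(1,3)]) (use Z in auto)
    then show "\<exists>c > 0. AE x in leb_on \<Theta>. dens (leb_on \<Theta>) \<rho> x =
        c * (dens (leb_on \<Theta>) M x *
             (dens lborel \<rho>y (G x) / dens lborel (distr M borel G) (G x)) powr (1 / (1 + \<alpha>)))"
      using Z by (intro exI[of _ "1 / Z"]) (auto simp: u_def elim!: eventually_mono)
  qed
qed

end
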